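(* For all integers $d>3$ and $1\le k\le d-1$, there exists an integer $N$ such that for every $n\ge N$ the cyclic $d$-polytope $\mathcal C_d(n)$ with $n$ vertices is not $k$-scribable.
   Context: The cyclic $d$-polytope $\mathcal C_d(n)$ ($n\ge d+1$) is the combinatorial type of $\operatorname{conv}(\gamma(t_1),\dots,\gamma(t_n))$ for $t_1<\dots<t_n$, where $\gamma(t)=(t,t^2,\dots,t^d)$ is the moment curve in $\mathbb R^d$ (the combinatorial type does not depend on the $t_i$). Let $\mathbb S^d=\{x\in\mathbb R^{d+1}:\|x\|_2=1\}$, with coordinates $x_0,\dots,x_d$. A spherical polytope is an intersection of finitely many closed hemispheres of $\mathbb S^d$ containing no two antipodal points; equivalently, $\mathcal P=\mathcal K\cap\mathbb S^d$ for a pointed polyhedral cone $\mathcal K\subset\mathbb R^{d+1}$. Its $k$-faces are the intersections with $\mathbb S^d$ of the $(k+1)$-dimensional faces of $\mathcal K$. A $d$-polytope is a polytope of dimension $d$. A realization of a combinatorial type of $d$-polytope is a spherical $d$-polytope in $\mathbb S^d$ with isomorphic face lattice. Let $\mathcal B=\{x\in\mathbb S^d: x_0\ge 0,\ -x_0^2+x_1^2+\dots+x_d^2\le 0\}$ (a spherical cap) and let $\mathcal S=\partial\mathcal B$ be its boundary sphere. For a face $F$, $\operatorname{Span}(F)$ denotes the intersection of the linear span of $F$ with $\mathbb S^d$. A face $F$ is tangent to $\mathcal S$ if $\operatorname{relint}(F)\cap\mathcal S$ consists of a single point and $\operatorname{Span}(F)$ does not meet the interior of $\mathcal B$. A spherical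 $d$-polytope is (strongly) $k$-scribed if every $k$-face is tangent to $\mathcal S$; a (combinatorial type of) $d$-polytope is $k$-scribable if it has a $k$-scribed realization. *)

theory Defs
  imports "HOL-Analysis.Analysis"
begin

definition closed_hemisphere :: "'a::euclidean_space set \<Rightarrow> bool" where
  "closed_hemisphere H \<longleftrightarrow> (\<exists>a. a \<noteq> 0 \<and> H = {x \<in> sphere 0 1. 0 \<le> a \<bullet> x})"

definition spherical_polytope :: "'a::euclidean_space set \<Rightarrow> bool" where
  "spherical_polytope P \<longleftrightarrow>
     (\<exists>\<H>. finite \<H> \<and> (\<forall>H\<in>\<H>. closed_hemisphere H) \<and> P = sphere 0 1 \<inter> \<Inter>\<H>) \<and>
     (\<forall>x\<in>P. - x \<notin> P)"

text \<open>The pointed polyhedral cone \<open>K\<close> with \<open>P = K \<inter> sphere 0 1\<close>; the origin is inserted so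
  that the cone over the empty polytope is \<open>{0}\<close>.\<close>

definition polytope_cone :: "'a::euclidean_space set \<Rightarrow> 'a set" where
  "polytope_cone P = conic hull (insert 0 P)"

definition spherical_faces :: "'a::euclidean_space set \<Rightarrow> 'a set set" where
  "spherical_faces P = {G \<inter> sphere 0 1 | G. G face_of polytope_cone P}"

definition spherical_face_of :: "nat \<Rightarrow> 'a::euclidean_space set \<Rightarrow> 'a set \<Rightarrow> bool" where
  "spherical_face_of k F P \<longleftrightarrow>
     (\<exists>G. G face_of polytope_cone P \<and> aff_dim G = int k + 1 \<and> F = G \<inter> sphere 0 1)"

definition spherical_d_polytope :: "nat \<Rightarrow> 'a::euclidean_space set \<Rightarrow> bool" where
  "spherical_d_polytope m P \<longleftrightarrow> spherical_polytope P \<and> aff_dim (polytope_cone P) = int m + 1"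

definition spherical_span :: "'a::euclidean_space set \<Rightarrow> 'a set" where
  "spherical_span F = span F \<inter> sphere 0 1"

definition spherical_relint :: "'a::euclidean_space set \<Rightarrow> 'a set" where
  "spherical_relint F = top_of_set (spherical_span F) interior_of F"

text \<open>With \<open>d = CARD('d)\<close>, the space \<open>real \<times> (real^'d)\<close> is the \<open>(d+1)\<close>-dimensional Euclidean
  space, and \<open>sphere 0 1\<close> in it is the unit \<open>d\<close>-sphere. The coordinate \<open>x\<^sub>0\<close> is \<open>fst x\<close>; the
  coordinates \<open>x\<^sub>1, \<dots>, x\<^sub>d\<close> are the components of \<open>snd x\<close>.\<close>

definition cap :: "(real \<times> (real^'d)) set" where
  "cap = {x \<in> sphere 0 1. 0 \<le> fst x \<and> - (fst x)\<^sup>2 + (\<Sum>i\<in>UNIV. (snd x $ i)\<^sup>2) \<le> 0}"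

text \<open>Boundary and interior of the cap are taken in the unit sphere, not in the ambient space.\<close>

definition cap_boundary :: "(real \<times> (real^'d)) set" where
  "cap_boundary = top_of_set (sphere 0 1) frontier_of cap"

definition cap_interior :: "(real \<times> (real^'d)) set" where
  "cap_interior = top_of_set (sphere 0 1) interior_of cap"

definition tangent_face :: "(real \<times> (real^'d)) set \<Rightarrow> bool" where
  "tangent_face F \<longleftrightarrow>
     (\<exists>p. spherical_relint F \<inter> cap_boundary = {p}) \<and> spherical_span F \<inter> cap_interior = {}"

definition k_scribed :: "nat \<Rightarrow> (real \<times> (real^'d)) set \<Rightarrow> bool" where
  "k_scribed k P \<longleftrightarrow> (\<forall>F. spherical_face_of k F P \<longrightarrow> tangent_face F)"

definition order_isomorphic :: "'a set set \<Rightarrow> 'b set set \<Rightarrow> bool" where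
  "order_isomorphic \<A> \<B> \<longleftrightarrow>
     (\<exists>f. bij_betw f \<A> \<B> \<and> (\<forall>X\<in>\<A>. \<forall>Y\<in>\<A>. X \<subseteq> Y \<longleftrightarrow> f X \<subseteq> f Y))"

text \<open>The combinatorial type is represented by a polytope \<open>C\<close> in \<open>real^'d\<close>. The relation
  \<open>face_of\<close> admits both the empty face and \<open>C\<close> itself, so \<open>{F. F face_of C}\<close> is the full face
  lattice; likewise \<open>spherical_faces P\<close>, where the faces \<open>{}\<close> and \<open>{0}\<close> of the cone both yield
  the empty face.\<close>

definition realizes :: "(real \<times> (real^'d)) set \<Rightarrow> (real^'d) set \<Rightarrow> bool" where
  "realizes P C \<longleftrightarrow>
     spherical_d_polytope CARD('d) P \<and> order_isomorphic {F. F face_of C} (spherical_faces P)"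

definition k_scribable :: "nat \<Rightarrow> (real^'d) set \<Rightarrow> bool" where
  "k_scribable k C \<longleftrightarrow> (\<exists>P. realizes P C \<and> k_scribed k P)"

text \<open>The order on the index type numbers the coordinates: the \<open>m\<close>-th smallest index carries
  \<open>t ^ m\<close>, so the curve is \<open>(t, t\<^sup>2, \<dots>, t ^ CARD('d))\<close>.\<close>

definition moment_curve :: "real \<Rightarrow> real^'d::{finite,linorder}" where
  "moment_curve t = (\<chi> i. t ^ card {j. j \<le> i})"

text \<open>The parameters \<open>t\<^sub>1 < \<dots> < t\<^sub>n\<close> are given as an \<open>n\<close>-element set of reals.\<close>

definition cyclic_polytope :: "nat \<Rightarrow> (real^'d::{finite,linorder}) set \<Rightarrow> bool" where
  "cyclic_polytope n C \<longleftrightarrow>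
     CARD('d) + 1 \<le> n \<and> (\<exists>T. finite T \<and> card T = n \<and> C = convex hull (moment_curve ` T))"

end

theory Submission
  imports Defs "HOL-Computational_Algebra.Polynomial"
begin

text \<open>Let \<open>v\<^sub>0, v\<^sub>1, \<dots>\<close> be unit vectors spanning the extreme rays of the cone over a \<open>k\<close>-scribed
  realization, in the order of the cyclic polytope, and equip the ambient space with the Lorentz
  form \<open>B\<close> whose light cone is the cone over the sphere. Tangency of a \<open>k\<close>-face means that \<open>B\<close> is
  positive semidefinite on its span, with kernel spanned by the tangent point, a positive
  combination of the vertices.

  If \<open>k \<le> d - 2\<close>, choose a set \<open>S\<close> of \<open>k - 1\<close> vertices and two further vertices \<open>a\<close>, \<open>c\<close> such that
  \<open>S \<union> {a, j}\<close> and \<open>S \<union> {c, j}\<close> are faces for all \<open>j\<close> in a set which together with \<open>S\<close> contains a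
  basis. Projecting along \<open>S\<close> and normalizing, \<open>a\<close> and \<open>c\<close> have the same product with every basis
  vector, so they coincide.

  If \<open>k = d - 1\<close>, let \<open>S\<close> consist of the first \<open>d - 4\<close> vertices and let \<open>u\<^sub>0, u\<^sub>1, \<dots>\<close> be the following
  ones. The facets \<open>S \<union> {u\<^sub>i, u\<^sub>i\<^sub>+\<^sub>1, u\<^sub>j, u\<^sub>j\<^sub>+\<^sub>1}\<close> have tangent points \<open>p\<^sub>i\<^sub>j\<close> in the 3-sphere
  orthogonal to \<open>S\<close>, each on the 2-spheres orthogonal to its vertices. Send \<open>p\<^sub>1\<^sub>3\<close> to infinity: the
  \<open>p\<^sub>i\<^sub>j\<close> with \<open>i = 1, 2, 3\<close> lie on three lines, consecutive ones meeting in \<open>p\<^sub>0\<^sub>2\<close> and \<open>p\<^sub>2\<^sub>4\<close>.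
  The power of these two points with respect to the sphere of \<open>u\<^sub>j\<close> can be computed on either of the
  lines, and comparing the results for several \<open>j\<close> shows that the circles of the edges \<open>u\<^sub>6 u\<^sub>7\<close> and
  \<open>u\<^sub>8 u\<^sub>9\<close> lie in parallel planes. Both contain \<open>p\<^sub>6\<^sub>8\<close>, so the planes coincide and the vertices
  become dependent.\<close>

subsection \<open>The Lorentz form\<close>

definition lorentz :: "real \<times> 'a::euclidean_space \<Rightarrow> real \<times> 'a \<Rightarrow> real" where
  "lorentz x y = snd x \<bullet> snd y - fst x * fst y"

lemma lorentz_commute: "lorentz x y = lorentz y x"
  by (simp add: lorentz_def inner_commute mult.commute)

lemma lorentz_zero [simp]: "lorentz 0 y = 0" "lorentz x 0 = 0"
  by (simp_all add: lorentz_def)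

lemma lorentz_linear:
  "lorentz (x + y) z = lorentz x z + lorentz y z"
  "lorentz z (x + y) = lorentz z x + lorentz z y"
  "lorentz (x - y) z = lorentz x z - lorentz y z"
  "lorentz z (x - y) = lorentz z x - lorentz z y"
  "lorentz (r *\<^sub>R x) z = r * lorentz x z"
  "lorentz z (r *\<^sub>R x) = r * lorentz z x"
  by (simp_all add: lorentz_def inner_add_left inner_add_right inner_diff_left inner_diff_right algebra_simps)

lemma lorentz_span:
  assumes "y \<in> span S" "\<And>s. s \<in> S \<Longrightarrow> lorentz x s = 0"
  shows "lorentz x y = 0"
  using assms(1) by (induction rule: span_induct_alt) (use assms(2) in \<open>auto simp: lorentz_linear\<close>)

text \<open>For a nondegenerate form the double orthogonal complement of a subspace is the subspace
  itself. Flipping the sign of the first coordinate turns the Euclidean normal part \<open>z\<close>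
  of \<open>y\<close> into a vector \<open>x\<close> with
  \<open>lorentz x w = z \<bullet> w\<close>.\<close>

lemma span_if_lorentz_orthogonal:
  fixes y :: "real \<times> 'a::euclidean_space"
  assumes "\<And>x. (\<And>s. s \<in> S \<Longrightarrow> lorentz x s = 0) \<Longrightarrow> lorentz x y = 0"
  shows "y \<in> span S"
proof -
  obtain s z where s: "s \<in> span S" and z: "\<And>w. w \<in> span S \<Longrightarrow> orthogonal z w" and y: "y = s + z"
    using orthogonal_subspace_decomp_exists[of S y] by metis
  define x where "x = (- fst z, snd z)"
  have x: "lorentz x w = z \<bullet> w" for w
    by (simp add: x_def lorentz_def inner_prod_def)
  have "lorentz x y = 0"
    using assms[of x] z by (simp add: x orthogonal_def span_base)
  then have "z = 0"
    using z[OF s] by (simp add: x y inner_simps orthogonal_def)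
  then show ?thesis using s y by simp
qed

lemma lorentz_nondegenerate:
  fixes x :: "real \<times> 'a::euclidean_space"
  assumes "span S = UNIV" "\<And>s. s \<in> S \<Longrightarrow> lorentz x s = 0"
  shows "x = 0"
proof -
  have "lorentz x (- fst x, snd x) = 0"
    using lorentz_span[of _ S x] assms by auto
  then have "x \<bullet> x = 0"
    by (simp add: lorentz_def inner_prod_def)
  then show ?thesis by simp
qed

text \<open>The form has a single negative direction, so an isotropic subspace is at most a line:
  cancelling the first coordinate of \<open>y\<close> by a multiple of \<open>x\<close> leaves a
  null vector on which the form is Euclidean.\<close>

lemma null_vectors_parallel:
  fixes x y :: "real \<times> 'a::euclidean_space"
  assumes "lorentz x x = 0" "lorentz y y = 0" "lorentz x y = 0" "x \<noteq> 0"
  shows "\<exists>c. y = c *\<^sub>R x"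
proof -
  have "fst x \<noteq> 0"
    using assms(1,4) by (auto simp: lorentz_def prod_eq_iff)
  define z where "z = y - (fst y / fst x) *\<^sub>R x"
  have "fst z = 0"
    using \<open>fst x \<noteq> 0\<close> by (simp add: z_def)
  moreover have "lorentz z z = 0"
    using assms lorentz_commute[of x y] by (simp add: z_def lorentz_linear)
  ultimately have "z = 0"
    by (simp add: lorentz_def prod_eq_iff)
  then show ?thesis by (auto simp: z_def)
qed

lemma semidefinite_null_orthogonal:
  assumes V: "subspace V" "\<And>x. x \<in> V \<Longrightarrow> 0 \<le> lorentz x x"
    and p: "p \<in> V" "lorentz p p = 0" and x: "x \<in> V"
  shows "lorentz p x = 0"
proof (rule ccontr)
  assume ne: "lorentz p x \<noteq> 0"
  \<comment> \<open>As \<open>p\<close> is null, the form is affine in the parameter along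
    \<open>x + t *\<^sub>R p\<close>; this \<open>t\<close> makes its value -1.\<close>
  define t where "t = - (lorentz x x + 1) / (2 * lorentz p x)"
  have "x + t *\<^sub>R p \<in> V"
    using V(1) p(1) x by (simp add: subspace_add subspace_scale)
  then have "0 \<le> lorentz (x + t *\<^sub>R p) (x + t *\<^sub>R p)" by (rule V(2))
  also have "\<dots> = lorentz x x + 2 * t * lorentz p x"
    using p(2) lorentz_commute[of x p] by (simp add: lorentz_linear)
  also have "\<dots> = -1"
    using ne by (simp add: t_def field_simps)
  finally show False by simp
qed

text \<open>Gram-Schmidt orthogonalization, which works for an indefinite form as long as it is
  definite on the subspace projected to.\<close>

lemma lorentz_projection:
  fixes x :: "real \<times> 'a::euclidean_space"
  assumes "finite S" "\<And>y. y \<in> span S \<Longrightarrow> y \<noteq> 0 \<Longrightarrow> 0 < lorentz y y"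
  shows "\<exists>w\<in>span S. \<forall>y\<in>span S. lorentz (x - w) y = 0"
  using assms
proof (induction S arbitrary: x rule: finite_induct)
  case empty
  then show ?case by simp
next
  case (insert a S)
  have sub: "span S \<subseteq> span (insert a S)"
    by (rule span_mono) auto
  have IH: "\<exists>w\<in>span S. \<forall>y\<in>span S. lorentz (x - w) y = 0" for x
    using insert.IH insert.prems sub by blast
  obtain w where w: "w \<in> span S" "\<And>y. y \<in> span S \<Longrightarrow> lorentz (x - w) y = 0"
    using IH by blast
  obtain b where b: "b \<in> span S" "\<And>y. y \<in> span S \<Longrightarrow> lorentz (a - b) y = 0"
    using IH by blast
  define e where "e = a - b"
  have e_in: "e \<in> span (insert a S)"
    unfolding e_def using b(1) sub by (auto intro: span_diff span_base)
  define r where "r = lorentz (x - w) e / lorentz e e"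
  \<comment> \<open>If \<open>a\<close> already lies in \<open>span S\<close>, then \<open>e\<close>
    may vanish; division by zero gives \<open>r = 0\<close> and the equation still holds.\<close>
  have r: "r * lorentz e e = lorentz (x - w) e"
    using insert.prems[OF e_in] by (cases "e = 0") (auto simp: r_def)
  have "w + r *\<^sub>R e \<in> span (insert a S)"
    using w(1) sub e_in by (auto intro: span_add span_scale)
  moreover have "lorentz (x - (w + r *\<^sub>R e)) y = 0" if y_in: "y \<in> span (insert a S)" for y
  proof -
    obtain k where "y - k *\<^sub>R a \<in> span S"
      using y_in by (auto simp: span_breakdown_eq)
    then have s: "y - k *\<^sub>R a + k *\<^sub>R b \<in> span S" (is "?s \<in> _")
      using b(1) by (intro span_add span_scale)
    have y: "y = k *\<^sub>R e + ?s"
      by (simp add: e_def algebra_simps)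
    have "lorentz (x - w - r *\<^sub>R e) ?s = 0"
      using w(2)[OF s] b(2)[OF s] unfolding e_def[symmetric] by (simp only: lorentz_linear(3,5))
    moreover have "lorentz (x - w - r *\<^sub>R e) (k *\<^sub>R e) = 0"
      using r by (simp add: lorentz_linear)
    ultimately have "lorentz (x - w - r *\<^sub>R e) (k *\<^sub>R e + ?s) = 0"
      by (simp only: lorentz_linear(2))
    then show ?thesis
      by (metis y diff_diff_eq)
  qed
  ultimately show ?case by blast
qed

section \<open>Tangency as a condition on spanning vectors\<close>

text \<open>The positive coefficients place the tangent point in the relative interior of the cone
  over \<open>X\<close>; semidefiniteness says that the span avoids the interior of the light
  cone.\<close>

definition tangent_vectors :: "(real \<times> 'a::euclidean_space) set \<Rightarrow> bool" where
  "tangent_vectors X \<longleftrightarrow>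
     (\<exists>c. (\<forall>x\<in>X. 0 < c x) \<and> (\<Sum>x\<in>X. c x *\<^sub>R x) \<noteq> 0 \<and>
        lorentz (\<Sum>x\<in>X. c x *\<^sub>R x) (\<Sum>x\<in>X. c x *\<^sub>R x) = 0 \<and>
        (\<forall>x\<in>span X. 0 \<le> lorentz x x))"

lemma tangent_vectorsE:
  assumes "tangent_vectors X"
  obtains p c where "p = (\<Sum>x\<in>X. c x *\<^sub>R x)" "\<And>x. x \<in> X \<Longrightarrow> 0 < c x" "p \<noteq> 0" "lorentz p p = 0"
    "\<And>x. x \<in> span X \<Longrightarrow> 0 \<le> lorentz x x" "\<And>x. x \<in> span X \<Longrightarrow> lorentz p x = 0" "p \<in> span X"
proof -
  obtain c where c: "\<And>x. x \<in> X \<Longrightarrow> 0 < c x" "(\<Sum>x\<in>X. c x *\<^sub>R x) \<noteq> 0"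
     "lorentz (\<Sum>x\<in>X. c x *\<^sub>R x) (\<Sum>x\<in>X. c x *\<^sub>R x) = 0" and pos: "\<And>x. x \<in> span X \<Longrightarrow> 0 \<le> lorentz x x"
    using assms unfolding tangent_vectors_def by blast
  have "(\<Sum>x\<in>X. c x *\<^sub>R x) \<in> span X"
    by (intro span_sum span_scale span_base)
  then show ?thesis
    using c pos that semidefinite_null_orthogonal[OF subspace_span pos] by blast
qed

text \<open>A null vector of the larger span is orthogonal to the tangent point and hence parallel
  to it. The tangent point has a positive coefficient at \<open>j\<close>, so it is not in
  \<open>span X\<close>.\<close>

lemma tangent_vectors_definite:
  assumes "tangent_vectors (insert j X)" "finite X" "j \<notin> span X" "x \<in> span X" "x \<noteq> 0"
  shows "0 < lorentz x x"
proof (rule ccontr)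
  assume neg: "\<not> 0 < lorentz x x"
  from assms(1) obtain p c where p: "p = (\<Sum>x\<in>insert j X. c x *\<^sub>R x)"
    "\<And>x. x \<in> insert j X \<Longrightarrow> 0 < c x" "p \<noteq> 0"
    "lorentz p p = 0" "\<And>x. x \<in> span (insert j X) \<Longrightarrow> 0 \<le> lorentz x x"
    "\<And>x. x \<in> span (insert j X) \<Longrightarrow> lorentz p x = 0" "p \<in> span (insert j X)"
    by (rule tangent_vectorsE) blast
  have x: "x \<in> span (insert j X)"
    using assms(4) span_mono[of X "insert j X"] by auto
  then have "lorentz x x = 0"
    using neg p(5)[OF x] by simp
  then obtain r where r: "p = r *\<^sub>R x"
    using null_vectors_parallel[of x p] p(4) p(6)[OF x] assms(5) lorentz_commute[of x p] by auto
  have jX: "j \<notin> X"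
    using assms(3) span_base by blast
  then have "j = (1 / c j) *\<^sub>R (r *\<^sub>R x - (\<Sum>x\<in>X. c x *\<^sub>R x))"
    using p(1) p(2)[of j] assms(2) by (simp add: r[symmetric])
  also have "\<dots> \<in> span X"
    by (intro span_scale span_diff span_sum assms(4)) (auto intro: span_scale span_base)
  finally show False using assms(3) by simp
qed

text \<open>Modulo \<open>span S\<close>, a tangent pair consists of caps touching each other.\<close>

lemma tangent_pair_product:
  assumes tan: "tangent_vectors (insert a (insert j S))" and "finite S"
    and j: "j \<notin> span (insert a S)" and a: "a \<notin> span (insert j S)"
    and ra: "ra \<in> span S" "\<And>y. y \<in> span S \<Longrightarrow> lorentz (a - ra) y = 0"
    and rj: "rj \<in> span S" "\<And>y. y \<in> span S \<Longrightarrow> lorentz (j - rj) y = 0"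
  shows "0 < lorentz (a - ra) (a - ra)"
    and "lorentz (a - ra) (j - rj) = - sqrt (lorentz (a - ra) (a - ra)) * sqrt (lorentz (j - rj) (j - rj))"
proof -
  have sub: "span S \<subseteq> span (insert a S)" "span S \<subseteq> span (insert j S)"
    by (auto intro: span_mono[THEN subsetD])
  have tan': "tangent_vectors (insert j (insert a S))"
    using tan by (simp add: insert_commute)
  note pa = tangent_vectors_definite[OF tan' _ j] and pj = tangent_vectors_definite[OF tan _ a]
  have "a - ra \<in> span (insert a S)" "a - ra \<noteq> 0"
    using ra(1) sub a by (auto intro: span_diff span_base)
  then show na: "0 < lorentz (a - ra) (a - ra)"
    using pa \<open>finite S\<close> by simp
  have "j - rj \<in> span (insert j S)" "j - rj \<noteq> 0"
    using rj(1) sub j by (auto intro: span_diff span_base)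
  then have nj: "0 < lorentz (j - rj) (j - rj)"
    using pj \<open>finite S\<close> by simp
  have nS: "0 < lorentz y y" if "y \<in> span S" "y \<noteq> 0" for y
    using pa[of y] \<open>finite S\<close> that sub by blast
  from tan obtain p c where p: "p = (\<Sum>x\<in>insert a (insert j S). c x *\<^sub>R x)"
    "\<And>x. x \<in> insert a (insert j S) \<Longrightarrow> 0 < c x" 
    "\<And>x. x \<in> span (insert a (insert j S)) \<Longrightarrow> lorentz p x = 0"
    by (rule tangent_vectorsE) blast
  have "a \<notin> insert j S" "j \<notin> S"
    using a j sub span_base by blast+
  then have psum: "p = c a *\<^sub>R a + (c j *\<^sub>R j + (\<Sum>x\<in>S. c x *\<^sub>R x))"
    using p(1) \<open>finite S\<close> by simp
  \<comment> \<open>Collects the components of the tangent point in \<open>span S\<close>; the rest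
    is a positive combination of the two residuals.\<close>
  define w where "w = c a *\<^sub>R ra + (c j *\<^sub>R rj + (\<Sum>x\<in>S. c x *\<^sub>R x))"
  have w: "w \<in> span S"
    unfolding w_def using ra rj by (intro span_add span_scale span_sum) (auto intro: span_base)
  define u where "u = a - ra"
  define v where "v = j - rj"
  have puv: "p = c a *\<^sub>R u + (c j *\<^sub>R v + w)"
    by (simp add: psum w_def u_def v_def algebra_simps)
  have "insert a S \<subseteq> insert a (insert j S)" "insert j S \<subseteq> insert a (insert j S)"
    by auto
  then have "u \<in> span (insert a (insert j S))" "v \<in> span (insert a (insert j S))" "w \<in> span (insert a (insert j S))"
    using \<open>a - ra \<in> _\<close> \<open>j - rj \<in> _\<close> w sub span_mono[of "insert a S" "insert a (insert j S)"]
      span_mono[of "insert j S" "insert a (insert j S)"] unfolding u_def v_def by blast+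
  then have pu: "lorentz p u = 0" and pv: "lorentz p v = 0" and pw: "lorentz p w = 0"
    using p(3) by blast+
  have uw: "lorentz u w = 0" and vw: "lorentz v w = 0"
    using w ra(2) rj(2) by (simp_all add: u_def v_def)
  \<comment> \<open>\<open>w\<close> is orthogonal to \<open>p\<close>, \<open>u\<close> and
    \<open>v\<close>, hence to itself, while the form is definite on \<open>span S\<close>.\<close>
  have "lorentz w w = 0"
    using pw uw vw by (simp add: puv lorentz_linear)
  then have w0: "w = 0"
    using nS[OF w] by fastforce
  have ca: "0 < c a" and cj: "0 < c j"
    using p(2) by auto
  \<comment> \<open>Orthogonality of \<open>p\<close> to \<open>u\<close> and \<open>v\<close> makes
    their Gram matrix singular with a positive kernel vector: equality in Cauchy-Schwarz, with a
    negative product.\<close>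
  have 1: "c a * lorentz u u + c j * lorentz u v = 0"
    using pu w0 lorentz_commute[of u v] by (simp add: puv lorentz_linear)
  have 2: "c a * lorentz u v + c j * lorentz v v = 0"
    using pv w0 by (simp add: puv lorentz_linear)
  have "c a * lorentz u u = - (c j * lorentz u v)" using 1 by simp
  then have neg: "lorentz u v < 0"
    using na ca cj unfolding u_def[symmetric]
    by (smt (verit) mult_pos_pos mult_nonneg_nonneg)
  have "c j * (lorentz u v)\<^sup>2 = - (c a * lorentz u u) * lorentz u v"
    using arg_cong[OF 1, of "\<lambda>z. z * lorentz u v"] by (simp add: power2_eq_square algebra_simps)
  also have "\<dots> = lorentz u u * (c j * lorentz v v)"
    using 2 by (simp add: algebra_simps add_eq_0_iff)
  finally have "(lorentz u v)\<^sup>2 = lorentz u u * lorentz v v"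
    using cj by simp
  then have "\<bar>lorentz u v\<bar> = sqrt (lorentz u u) * sqrt (lorentz v v)"
    by (metis real_sqrt_abs real_sqrt_mult)
  then show "lorentz (a - ra) (j - rj) = - sqrt (lorentz (a - ra) (a - ra)) * sqrt (lorentz (j - rj) (j - rj))"
    using neg unfolding u_def[symmetric] v_def[symmetric] by simp
qed

text \<open>The product of a normalized residual of \<open>a\<close> or \<open>c\<close> with the
  residual of \<open>j\<close> depends on \<open>j\<close> alone, so by nondegeneracy the two
  normalized residuals agree and \<open>c\<close> falls into
  \<open>span (insert a S)\<close>.\<close>

lemma no_two_tangent_pencils:
  fixes S J :: "(real \<times> 'a::euclidean_space) set"
  assumes "finite S" and "J \<noteq> {}" and span: "span (S \<union> J) = UNIV"
    and tan: "\<And>x j. x \<in> {a, c} \<Longrightarrow> j \<in> J \<Longrightarrow> tangent_vectors (insert x (insert j S))"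
    and j: "\<And>x j. x \<in> {a, c} \<Longrightarrow> j \<in> J \<Longrightarrow> j \<notin> span (insert x S)"
    and x: "\<And>x j. x \<in> {a, c} \<Longrightarrow> j \<in> J \<Longrightarrow> x \<notin> span (insert j S)"
    and ac: "c \<notin> span (insert a S)"
  shows False
proof -
  obtain j0 where j0: "j0 \<in> J" using \<open>J \<noteq> {}\<close> by blast
  have "\<exists>w\<in>span S. \<forall>y\<in>span S. lorentz (x - w) y = 0" for x
  proof (rule lorentz_projection)
    have sub: "span S \<subseteq> span (insert j0 S)"
      by (auto intro: span_mono[THEN subsetD])
    show "0 < lorentz y y" if "y \<in> span S" "y \<noteq> 0" for y
      using tangent_vectors_definite[of a "insert j0 S" y] tan x j0 that sub \<open>finite S\<close> by auto
  qed fact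
  then obtain r where r: "\<And>x. r x \<in> span S" "\<And>x y. y \<in> span S \<Longrightarrow> lorentz (x - r x) y = 0"
    by metis
  define e where "e = (\<lambda>x. (1 / sqrt (lorentz (x - r x) (x - r x))) *\<^sub>R (x - r x))"
  have e: "lorentz (e x) (j - r j) = - sqrt (lorentz (j - r j) (j - r j))" "0 < lorentz (x - r x) (x - r x)"
    if "x \<in> {a, c}" "j \<in> J" for x j
    using tangent_pair_product[OF tan[OF that] \<open>finite S\<close> assms(5)[OF that] assms(6)[OF that] r r]
    unfolding e_def by (simp_all add: lorentz_linear(5))
  have eS: "lorentz (e x) y = 0" if "y \<in> span S" for x y
    using r(2)[OF that, of x] by (simp add: e_def lorentz_linear(5))
  have "e a - e c = 0"
  proof (rule lorentz_nondegenerate[OF span])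
    fix y assume "y \<in> S \<union> J"
    then consider "y \<in> S" | "y \<in> J" by blast
    then show "lorentz (e a - e c) y = 0"
    proof cases
      case 1 then show ?thesis using eS[of y] by (simp add: span_base lorentz_linear)
    next
      case 2
      have "lorentz (e x) y = lorentz (e x) (y - r y)" for x
        using eS[OF r(1), of x y] by (simp add: lorentz_linear)
      then show ?thesis using e(1)[OF _ 2, of a] e(1)[OF _ 2, of c] by (simp add: lorentz_linear(3))
    qed
  qed
  define s where "s = (\<lambda>x. sqrt (lorentz (x - r x) (x - r x)))"
  have s: "s x > 0" if "x \<in> {a,c}" for x using e(2)[OF that j0] by (simp add: s_def)
  have "e x = (1 / s x) *\<^sub>R (x - r x)" for x
    by (simp add: e_def s_def)
  then have "c - r c = s c *\<^sub>R e c"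
    using s[of c] by simp
  also have "\<dots> = s c *\<^sub>R e a" using \<open>e a - e c = 0\<close> by simp
  finally have "c = s c *\<^sub>R (1 / s a) *\<^sub>R (a - r a) + r c"
    by (simp add: e_def s_def algebra_simps)
  moreover have "r a \<in> span (insert a S)" "r c \<in> span (insert a S)"
    using r(1) span_mono[OF subset_insertI[of S a]] by blast+
  then have "s c *\<^sub>R (1 / s a) *\<^sub>R (a - r a) + r c \<in> span (insert a S)"
    by (intro span_add span_scale span_diff) (auto intro: span_base)
  ultimately have "c \<in> span (insert a S)" by simp
  then show False using ac by blast
qed

subsection \<open>Tangent facets\<close>

text \<open>Gaussian elimination in the complement of \<open>S\<close>: subtracting a multiple of
  the first \<open>e\<close> makes \<open>x\<close> orthogonal to its test vector \<open>f\<close>,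
  which then joins \<open>S\<close>. By triangularity the later \<open>e'\<close> are already
  orthogonal to \<open>f\<close>.\<close>

lemma lorentz_triangular:
  fixes S :: "(real \<times> 'a::euclidean_space) set"
  assumes "sorted_wrt (\<lambda>(e, f) (e', f'). lorentz e' f = 0) ps"
    and "\<And>e f. (e, f) \<in> set ps \<Longrightarrow> lorentz e f \<noteq> 0 \<and> (\<forall>s\<in>S. lorentz e s = 0)"
    and "\<And>z. (\<forall>s\<in>S. lorentz z s = 0) \<Longrightarrow> (\<forall>f\<in>snd ` set ps. lorentz z f = 0) \<Longrightarrow> z = 0"
    and "\<And>s. s \<in> S \<Longrightarrow> lorentz x s = 0"
  shows "x \<in> span (fst ` set ps)"
  using assms
proof (induction ps arbitrary: S x)
  case Nil
  then show ?case by auto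
next
  case (Cons ef ps)
  obtain e f where ef: "ef = (e, f)" by (cases ef)
  define x' where "x' = x - (lorentz x f / lorentz e f) *\<^sub>R e"
  have nz: "lorentz e f \<noteq> 0" "\<And>s. s \<in> S \<Longrightarrow> lorentz e s = 0"
    using Cons.prems(2)[of e f] by (auto simp: ef)
  have "x' \<in> span (fst ` set ps)"
  proof (rule Cons.IH[of "insert f S"])
    show "sorted_wrt (\<lambda>(e, f) (e', f'). lorentz e' f = 0) ps"
      using Cons.prems(1) by simp
    show "lorentz e' f' \<noteq> 0 \<and> (\<forall>s\<in>insert f S. lorentz e' s = 0)" if "(e', f') \<in> set ps" for e' f'
      using Cons.prems(1) Cons.prems(2)[of e' f'] that by (auto simp: ef)
    show "z = 0" if "\<forall>s\<in>insert f S. lorentz z s = 0" "\<forall>f\<in>snd ` set ps. lorentz z f = 0" for z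
      using Cons.prems(3)[of z] that by (simp add: ef)
    show "lorentz x' s = 0" if "s \<in> insert f S" for s
      using that nz nz(2)[of s] Cons.prems(4)[of s] by (cases "s = f") (simp_all add: x'_def lorentz_linear)
  qed
  then have "x' \<in> span (fst ` set (ef # ps))"
    by (auto intro: span_mono[THEN subsetD])
  moreover have "e \<in> span (fst ` set (ef # ps))"
    by (auto simp: ef intro: span_base)
  ultimately have "x' + (lorentz x f / lorentz e f) *\<^sub>R e \<in> span (fst ` set (ef # ps))"
    by (intro span_add span_scale)
  then show ?case by (simp add: x'_def)
qed

lemma span3E:
  assumes "x \<in> span {a, b, c}"
  obtains r s t where "x = r *\<^sub>R a + s *\<^sub>R b + t *\<^sub>R c"
proof -
  obtain r where "x - r *\<^sub>R a \<in> span {b, c}" using assms by (auto simp: span_breakdown_eq)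
  then obtain s where "x - r *\<^sub>R a - s *\<^sub>R b \<in> span {c}" by (auto simp: span_breakdown_eq)
  then obtain t where "x - r *\<^sub>R a - s *\<^sub>R b = t *\<^sub>R c" by (auto simp: span_singleton)
  then have "x = r *\<^sub>R a + s *\<^sub>R b + t *\<^sub>R c" by (simp add: algebra_simps)
  then show ?thesis by (rule that)
qed

text \<open>With the null vector \<open>q\<close> sent to infinity, the vectors \<open>p\<close> are points on a line through the
  origin \<open>z\<close> with coordinate \<open>t\<close>, and \<open>U j\<close> is a sphere meeting the line in \<open>p (j - 1)\<close> and
  \<open>p j\<close>; the product of the two coordinates is the power of the origin.\<close>

lemma line_coordinates:
  fixes p U :: "nat \<Rightarrow> real \<times> 'a::euclidean_space"
  assumes q: "lorentz q q = 0" and z: "lorentz z z = 0" "lorentz z q = 1"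
    and p: "\<And>j. j \<in> {5..9} \<Longrightarrow> lorentz (p j) (p j) = 0" "\<And>j. j \<in> {5..9} \<Longrightarrow> lorentz (p j) q = 1"
      "\<And>j. j \<in> {5..9} \<Longrightarrow> lorentz (p j) z \<noteq> 0"
      "\<And>i j. i \<in> {5..9} \<Longrightarrow> j \<in> {5..9} \<Longrightarrow> i \<noteq> j \<Longrightarrow> lorentz (p i) (p j) \<noteq> 0"
    and line: "\<And>j. j \<in> {5..9} \<Longrightarrow> p j \<in> span {p 5, z, q}"
    and U: "\<And>j. j \<in> {6..9} \<Longrightarrow> lorentz (U j) q = 1"
      "\<And>j. j \<in> {6..9} \<Longrightarrow> lorentz (p j) (U j) = 0" "\<And>j. j \<in> {6..9} \<Longrightarrow> lorentz (p (j - 1)) (U j) = 0"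
  obtains N t where "N \<noteq> 0" "\<And>j. j \<in> {5..9} \<Longrightarrow> t j \<noteq> 0"
    "\<And>i j. i \<in> {5..9} \<Longrightarrow> j \<in> {5..9} \<Longrightarrow> i \<noteq> j \<Longrightarrow> t i \<noteq> t j"
    "\<And>j. j \<in> {6..9} \<Longrightarrow> lorentz z (U j) = - N * t (j - 1) * t j"
    "\<And>j. j \<in> {6..8} \<Longrightarrow>
       lorentz (p 7 - p 5) (U (Suc j) - U j) = N * (t 7 - t 5) * (t (Suc j) - t (j - 1))"
proof -
  \<comment> \<open>The direction of the line, corrected by \<open>q\<close> so that it is
    orthogonal to both \<open>z\<close> and \<open>q\<close>.\<close>
  define l where "l = p 5 - z - lorentz (p 5) z *\<^sub>R q"
  define N where "N = lorentz l l / 2"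
  have qo: "lorentz q z = 1" using z(2) lorentz_commute[of q z] by simp
  have lq: "lorentz l q = 0" and lo: "lorentz l z = 0"
    using q z p(2)[of 5] qo by (simp_all add: l_def lorentz_linear)
  have ql: "lorentz q l = 0" and ol: "lorentz z l = 0"
    using lq lo lorentz_commute by metis+
  have N5: "N = - lorentz (p 5) z"
    using q z qo p(1,2)[of 5] lorentz_commute[of "p 5" z] lorentz_commute[of "p 5" q]
    by (simp add: N_def l_def lorentz_linear)
  then have N: "N \<noteq> 0" using p(3)[of 5] by simp
  \<comment> \<open>The product 1 with \<open>q\<close> fixes the coefficient of \<open>z\<close>,
    and nullity fixes that of \<open>q\<close>, leaving one parameter.\<close>
  have "\<exists>t. p j = z + t *\<^sub>R l - (N * t\<^sup>2) *\<^sub>R q" if j: "j \<in> {5..9}" for j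
  proof -
    obtain r s x where rsx: "p j = r *\<^sub>R p 5 + s *\<^sub>R z + x *\<^sub>R q"
      using line[OF j] by (rule span3E)
    have rs: "r + s = 1"
      using p(2)[OF j] p(2)[of 5] q z by (simp add: rsx lorentz_linear)
    define y where "y = x + r * lorentz (p 5) z"
    have pj: "p j = z + r *\<^sub>R l + y *\<^sub>R q"
      using rs by (simp add: rsx l_def y_def algebra_simps flip: scaleR_add_left)
    have "0 = lorentz (p j) (p j)" using p(1)[OF j] by simp
    also have "\<dots> = 2 * y + 2 * N * r\<^sup>2"
      by (simp add: pj lorentz_linear q z qo lq lo ql ol N_def power2_eq_square algebra_simps)
    finally have "y = - (N * r\<^sup>2)" by simp
    then show ?thesis using pj by auto
  qed
  then obtain t where t: "\<And>j. j \<in> {5..9} \<Longrightarrow> p j = z + t j *\<^sub>R l - (N * (t j)\<^sup>2) *\<^sub>R q"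
    by metis
  have t0: "t j \<noteq> 0" if "j \<in> {5..9}" for j
    using p(3)[OF that] t[OF that] z(1) by auto
  have tinj: "t i \<noteq> t j" if "i \<in> {5..9}" "j \<in> {5..9}" "i \<noteq> j" for i j
  proof
    assume "t i = t j"
    then have "p i = p j" using t that(1,2) by simp
    then show False using p(1)[OF that(1)] p(4)[OF that] by simp
  qed
  have root: "lorentz z (U j) + t i * lorentz l (U j) - N * (t i)\<^sup>2 = 0"
    if "i \<in> {5..9}" "j \<in> {6..9}" "lorentz (p i) (U j) = 0" for i j
    using that t[OF that(1)] U(1)[OF that(2)] lorentz_commute[of "U j" q] by (simp add: lorentz_linear)
  \<comment> \<open>Both \<open>t (j - 1)\<close> and \<open>t j\<close> are roots of the same
    quadratic, and they differ; these are Vieta's formulas for their sum and product.\<close>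
  have vieta: "lorentz l (U j) = N * (t (j - 1) + t j)" "lorentz z (U j) = - N * t (j - 1) * t j"
    if j: "j \<in> {6..9}" for j
  proof -
    have j': "j - 1 \<in> {5..9}" "j \<in> {5..9}" "j - 1 \<noteq> j" using j by auto
    have "lorentz z (U j) + t (j - 1) * lorentz l (U j) - N * (t (j - 1))\<^sup>2 = 0"
      "lorentz z (U j) + t j * lorentz l (U j) - N * (t j)\<^sup>2 = 0"
      using root j' j U by blast+
    moreover from this have "(t (j - 1) - t j) * (lorentz l (U j) - N * (t (j - 1) + t j)) = 0"
      by algebra
    ultimately show "lorentz l (U j) = N * (t (j - 1) + t j)" "lorentz z (U j) = - N * t (j - 1) * t j"
      using tinj[OF j'] by (simp, algebra)
  qed
  have "lorentz (p 7 - p 5) (U (Suc j) - U j) = N * (t 7 - t 5) * (t (Suc j) - t (j - 1))"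
    if j: "j \<in> {6..8}" for j
  proof -
    \<comment> \<open>In \<open>p 7 - p 5\<close> the \<open>z\<close> parts cancel and the
      \<open>q\<close> part has product 0 with this difference, so only the multiple of
      \<open>l\<close> counts.\<close>
    have "lorentz q (U (Suc j) - U j) = 0"
      using U(1)[of j] U(1)[of "Suc j"] j lorentz_commute[of q] by (simp add: lorentz_linear)
    then have "lorentz (p 7 - p 5) (U (Suc j) - U j) = (t 7 - t 5) * lorentz l (U (Suc j) - U j)"
      by (simp add: t lorentz_linear(1,3,5) left_diff_distrib)
    also have "lorentz l (U (Suc j) - U j) = N * (t (Suc j) - t (j - 1))"
      using vieta(1)[of j] vieta(1)[of "Suc j"] j by (simp add: lorentz_linear algebra_simps)
    finally show ?thesis by simp
  qed
  then show ?thesis using N t0 tinj vieta(2) that by blast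
qed

text \<open>Dividing the equations for \<open>j = 6, 7\<close> and those for \<open>j = 8, 9\<close>
  eliminates the even indices: the coordinates at 5, 7, 9 are proportional on the two lines, hence
  so are their differences.\<close>

lemma equal_products_proportional:
  fixes t t' :: "nat \<Rightarrow> real"
  assumes N: "N \<noteq> 0" and t': "\<And>j. j \<in> {5..9} \<Longrightarrow> t j \<noteq> 0" "\<And>j. j \<in> {5..9} \<Longrightarrow> t' j \<noteq> 0"
    and eq: "\<And>j. j \<in> {6..9} \<Longrightarrow> N * t (j - 1) * t j = N' * t' (j - 1) * t' j"
  shows "(t 7 - t 5) * (t' 9 - t' 7) = (t' 7 - t' 5) * (t 9 - t 7)"
proof -
  have e: "N * t 5 * t 6 = N' * t' 5 * t' 6" "N * t 6 * t 7 = N' * t' 6 * t' 7"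
    "N * t 7 * t 8 = N' * t' 7 * t' 8" "N * t 8 * t 9 = N' * t' 8 * t' 9"
    using eq[of 6] eq[of 7] eq[of 8] eq[of 9] by simp_all
  have "N * t 6 * (t 5 * t' 7 - t 7 * t' 5) = 0" using e(1,2) by algebra
  then have 1: "t 5 * t' 7 = t 7 * t' 5" using N t'(1)[of 6] by simp
  have "N * t 8 * (t 7 * t' 9 - t 9 * t' 7) = 0" using e(3,4) by algebra
  then have 2: "t 7 * t' 9 = t 9 * t' 7" using N t'(1)[of 8] by simp
  have "t 7 * t' 7 * (t 5 * t' 9 - t 9 * t' 5) = 0" using 1 2 by algebra
  then have "t 5 * t' 9 = t 9 * t' 5" using t'(1)[of 7] t'(2)[of 7] by simp
  then show ?thesis using 1 2 by (simp add: algebra_simps)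
qed

text \<open>Both lines pass through \<open>z\<close>, whose power with respect to each sphere
  \<open>U j\<close> does not depend on the line. The differences \<open>U 7 - U 6\<close> and
  \<open>U 9 - U 8\<close> are normals of radical planes, and the conclusion compares their
  components along the two lines.\<close>

lemma two_lines:
  fixes p p' U :: "nat \<Rightarrow> real \<times> 'a::euclidean_space"
  assumes q: "lorentz q q = 0" and z: "lorentz z z = 0" "lorentz z q = 1"
    and p: "\<And>j. j \<in> {5..9} \<Longrightarrow> lorentz (p j) (p j) = 0" "\<And>j. j \<in> {5..9} \<Longrightarrow> lorentz (p j) q = 1"
      "\<And>j. j \<in> {5..9} \<Longrightarrow> lorentz (p j) z \<noteq> 0"
      "\<And>i j. i \<in> {5..9} \<Longrightarrow> j \<in> {5..9} \<Longrightarrow> i \<noteq> j \<Longrightarrow> lorentz (p i) (p j) \<noteq> 0"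
      "\<And>j. j \<in> {5..9} \<Longrightarrow> p j \<in> span {p 5, z, q}"
    and p': "\<And>j. j \<in> {5..9} \<Longrightarrow> lorentz (p' j) (p' j) = 0" "\<And>j. j \<in> {5..9} \<Longrightarrow> lorentz (p' j) q = 1"
      "\<And>j. j \<in> {5..9} \<Longrightarrow> lorentz (p' j) z \<noteq> 0"
      "\<And>i j. i \<in> {5..9} \<Longrightarrow> j \<in> {5..9} \<Longrightarrow> i \<noteq> j \<Longrightarrow> lorentz (p' i) (p' j) \<noteq> 0"
      "\<And>j. j \<in> {5..9} \<Longrightarrow> p' j \<in> span {p' 5, z, q}"
    and U: "\<And>j. j \<in> {6..9} \<Longrightarrow> lorentz (U j) q = 1"
      "\<And>j. j \<in> {6..9} \<Longrightarrow> lorentz (p j) (U j) = 0" "\<And>j. j \<in> {6..9} \<Longrightarrow> lorentz (p (j - 1)) (U j) = 0"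
      "\<And>j. j \<in> {6..9} \<Longrightarrow> lorentz (p' j) (U j) = 0" "\<And>j. j \<in> {6..9} \<Longrightarrow> lorentz (p' (j - 1)) (U j) = 0"
  shows "lorentz (p 7 - p 5) (U 7 - U 6) * lorentz (p' 7 - p' 5) (U 9 - U 8) =
      lorentz (p' 7 - p' 5) (U 7 - U 6) * lorentz (p 7 - p 5) (U 9 - U 8)"
    and "lorentz (p 7 - p 5) (U 7 - U 6) \<noteq> 0"
proof -
  obtain N t where t: "N \<noteq> 0" "\<And>j. j \<in> {5..9} \<Longrightarrow> t j \<noteq> 0"
    "\<And>i j. i \<in> {5..9} \<Longrightarrow> j \<in> {5..9} \<Longrightarrow> i \<noteq> j \<Longrightarrow> t i \<noteq> t j"
    "\<And>j. j \<in> {6..9} \<Longrightarrow> lorentz z (U j) = - N * t (j - 1) * t j"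
    "\<And>j. j \<in> {6..8} \<Longrightarrow>
       lorentz (p 7 - p 5) (U (Suc j) - U j) = N * (t 7 - t 5) * (t (Suc j) - t (j - 1))"
    using line_coordinates[OF q z p U(1-3)] by blast
  obtain N' t' where t': "N' \<noteq> 0" "\<And>j. j \<in> {5..9} \<Longrightarrow> t' j \<noteq> 0"
    "\<And>i j. i \<in> {5..9} \<Longrightarrow> j \<in> {5..9} \<Longrightarrow> i \<noteq> j \<Longrightarrow> t' i \<noteq> t' j"
    "\<And>j. j \<in> {6..9} \<Longrightarrow> lorentz z (U j) = - N' * t' (j - 1) * t' j"
    "\<And>j. j \<in> {6..8} \<Longrightarrow>
       lorentz (p' 7 - p' 5) (U (Suc j) - U j) = N' * (t' 7 - t' 5) * (t' (Suc j) - t' (j - 1))"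
    using line_coordinates[OF q z p' U(1,4,5)] by blast
  have "(t 7 - t 5) * (t' 9 - t' 7) = (t' 7 - t' 5) * (t 9 - t 7)"
    using equal_products_proportional[where N = N and N' = N' and t = t and t' = t'] t(1,2) t'(2) t(4) t'(4)
    by force
  then have "N * (t 7 - t 5) * (t 7 - t 5) * (N' * (t' 7 - t' 5) * (t' 9 - t' 7)) =
    N' * (t' 7 - t' 5) * (t' 7 - t' 5) * (N * (t 7 - t 5) * (t 9 - t 7))"
    by algebra
  then show "lorentz (p 7 - p 5) (U 7 - U 6) * lorentz (p' 7 - p' 5) (U 9 - U 8) =
      lorentz (p' 7 - p' 5) (U 7 - U 6) * lorentz (p 7 - p 5) (U 9 - U 8)"
    using t(5)[of 6] t(5)[of 8] t'(5)[of 6] t'(5)[of 8] by simp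
  show "lorentz (p 7 - p 5) (U 7 - U 6) \<noteq> 0"
    using t(5)[of 6] t(1) t(3)[of 7 5] by simp
qed

text \<open>The algebraic core of the facet case: \<open>p i j\<close> is the tangent point of the
  facet on \<open>S\<close> and the \<open>u x\<close> with \<open>x\<close> in
  \<open>{i, i + 1, j, j + 1}\<close>, and \<open>inc\<close> says that it is orthogonal to no other
  \<open>u x\<close> with \<open>x \<le> 10\<close>.\<close>

lemma no_tangent_facets:
  fixes S :: "(real \<times> 'a::euclidean_space) set" and u :: "nat \<Rightarrow> real \<times> 'a"
  assumes null: "\<And>i j. i + 2 \<le> j \<Longrightarrow> j \<le> 9 \<Longrightarrow> lorentz (p i j) (p i j) = 0"
    and S: "\<And>i j s. i + 2 \<le> j \<Longrightarrow> j \<le> 9 \<Longrightarrow> s \<in> S \<Longrightarrow> lorentz (p i j) s = 0"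
    and inc: "\<And>i j x. i + 2 \<le> j \<Longrightarrow> j \<le> 9 \<Longrightarrow> x \<le> 10 \<Longrightarrow>
      lorentz (p i j) (u x) = 0 \<longleftrightarrow> x \<in> {i, i + 1, j, j + 1}"
    and basis: "\<And>z. (\<And>s. s \<in> S \<Longrightarrow> lorentz z s = 0) \<Longrightarrow>
      (\<And>x. x \<in> {1..5} \<Longrightarrow> lorentz z (u x) = 0) \<Longrightarrow> z = 0"
    and indep: "u 9 \<notin> span (insert (u 6) (insert (u 7) (insert (u 8) S)))"
  shows False
proof -
  \<comment> \<open>Orthogonal null vectors are parallel and so orthogonal to the same vertices;
    \<open>i\<close> and \<open>j + 1\<close> are recovered as the smallest and the largest of the
    four indices.\<close>
  have distinct: "lorentz (p i j) (p k l) \<noteq> 0"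
    if ij: "i + 2 \<le> j" "j \<le> 9" and kl: "k + 2 \<le> l" "l \<le> 9" and ne: "(i, j) \<noteq> (k, l)" for i j k l
  proof
    assume "lorentz (p i j) (p k l) = 0"
    have nz: "p i j \<noteq> 0" if "i + 2 \<le> j" "j \<le> 9" for i j
    proof
      assume "p i j = 0"
      then have "x \<in> {i, i + 1, j, j + 1}" if "x \<le> 10" for x
        using inc[of i j x] \<open>i + 2 \<le> j\<close> \<open>j \<le> 9\<close> that by simp
      then have "{..10} \<subseteq> {i, i + 1, j, j + 1}" by auto
      then have "card {..10::nat} \<le> card {i, i + 1, j, j + 1}" by (intro card_mono) auto
      also have "\<dots> \<le> 4" using card_length[of "[i, i + 1, j, j + 1]"] by simp
      finally show False by simp
    qed
    obtain c where c: "p k l = c *\<^sub>R p i j"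
      using null_vectors_parallel[OF null[OF ij] null[OF kl]] \<open>lorentz _ _ = 0\<close> nz[OF ij] by blast
    then have "c \<noteq> 0" using nz[OF kl] by auto
    then have same: "x \<in> {i, i + 1, j, j + 1} \<longleftrightarrow> x \<in> {k, k + 1, l, l + 1}" if "x \<le> 10" for x
      using inc[OF ij that] inc[OF kl that] by (simp add: c lorentz_linear)
    show False
      using same[of i] same[of k] same[of "j + 1"] same[of "l + 1"] ij kl ne by auto
  qed
  \<comment> \<open>\<open>q\<close> becomes the point at infinity; vectors not orthogonal to it are
    normalized to product 1.\<close>
  define q where "q = p 1 3"
  define N where "N = (\<lambda>x. (1 / lorentz x q) *\<^sub>R x)"
  have N: "lorentz (N x) q = 1" if "lorentz x q \<noteq> 0" for x
    using that by (simp add: N_def lorentz_linear)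
  have Nl: "lorentz (N x) y = lorentz x y / lorentz x q" for x y
    by (simp add: N_def lorentz_linear)
  have Nr: "lorentz y (N x) = lorentz y x / lorentz x q" for x y
    by (simp add: N_def lorentz_linear)
  have qp: "lorentz (p i j) q \<noteq> 0" if "i + 2 \<le> j" "j \<le> 9" "(i, j) \<noteq> (1, 3)" for i j
    unfolding q_def using distinct[of i j 1 3] that by auto
  have qu: "lorentz (u x) q \<noteq> 0" if "x \<in> {5..10}" for x
    using inc[of 1 3 x] that lorentz_commute[of "u x"] by (auto simp: q_def)
  \<comment> \<open>\<open>z\<close> is orthogonal to \<open>u 1, u 2, u 3\<close> and
    \<open>z'\<close> to \<open>u 2, u 3, u 4\<close>, so \<open>z\<close> lies on the lines with
    \<open>i = 1, 2\<close> and \<open>z'\<close> on those with \<open>i = 2, 3\<close>.\<close>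
  define z z' where "z = N (p 0 2)" and "z' = N (p 2 4)"
  define P where "P = (\<lambda>i j. N (p i j))"
  define U where "U = (\<lambda>j. N (u j))"
  have q0: "lorentz q q = 0" "\<And>s. s \<in> S \<Longrightarrow> lorentz q s = 0"
    using null[of 1 3] S[of 1 3] by (simp_all add: q_def)
  have qinc: "lorentz q (u x) = 0 \<longleftrightarrow> x \<in> {1,2,3,4}" if "x \<le> 10" for x
    using inc[of 1 3 x] that by (auto simp: q_def)
  have Pinc: "lorentz (P i j) (u x) = 0 \<longleftrightarrow> x \<in> {i, i + 1, j, j + 1}"
    if "i \<in> {1,2,3}" "j \<in> {5..9}" "x \<le> 10" for i j x
    using inc[of i j x] qp[of i j] that by (auto simp: P_def Nl)
  have zinc: "lorentz z (u x) = 0 \<longleftrightarrow> x \<in> {0,1,2,3}" if "x \<le> 10" for x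
    using inc[of 0 2 x] qp[of 0 2] that by (auto simp: z_def Nl)
  have z'inc: "lorentz z' (u x) = 0 \<longleftrightarrow> x \<in> {2,3,4,5}" if "x \<le> 10" for x
    using inc[of 2 4 x] qp[of 2 4] that by (auto simp: z'_def Nl)
  have PS: "lorentz (P i j) s = 0" "lorentz z s = 0" "lorentz z' s = 0"
    if "i \<in> {1,2,3}" "j \<in> {5..9}" "s \<in> S" for i j s
    using S[of i j s] S[of 0 2 s] S[of 2 4 s] that by (auto simp: P_def z_def z'_def Nl)
  have z0: "lorentz z z = 0" "lorentz z q = 1" "lorentz z' z' = 0" "lorentz z' q = 1"
    using null[of 0 2] null[of 2 4] qp[of 0 2] qp[of 2 4] by (simp_all add: z_def z'_def N Nl Nr)
  have P0: "lorentz (P i j) (P i j) = 0" "lorentz (P i j) q = 1" "lorentz (P i j) z \<noteq> 0" "lorentz (P i j) z' \<noteq> 0"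
    if "i \<in> {1,2,3}" "j \<in> {5..9}" for i j
    using null[of i j] qp[of i j] distinct[of i j 0 2] distinct[of i j 2 4] qp[of 0 2] qp[of 2 4] that
    by (auto simp: P_def z_def z'_def N Nl Nr)
  have Pd: "lorentz (P i j) (P i k) \<noteq> 0" if "i \<in> {1,2,3}" "j \<in> {5..9}" "k \<in> {5..9}" "j \<noteq> k" for i j k
    using distinct[of i j i k] qp[of i j] qp[of i k] that by (auto simp: P_def Nl Nr)
  have Uq: "lorentz (U j) q = 1" if "j \<in> {6..9}" for j
    using qu[of j] that by (simp add: U_def N)
  have UP: "lorentz (P i j) (U j) = 0" "lorentz (P i (j - 1)) (U j) = 0" if "i \<in> {1,2,3}" "j \<in> {6..9}" for i j
  proof -
    have "j \<in> {5..9}" "j - 1 \<in> {5..9}" "j \<le> 10" "j = j - 1 + 1" using that by auto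
    then show "lorentz (P i j) (U j) = 0" "lorentz (P i (j - 1)) (U j) = 0"
      using Pinc[of i j j] Pinc[of i "j - 1" j] that(1) by (simp_all add: U_def Nr)
  qed
  \<comment> \<open>The vectors orthogonal to \<open>S\<close>, \<open>u i\<close> and
    \<open>u i'\<close> form a three-dimensional space, in which \<open>a, b, q\<close> are
    triangular against \<open>u f, u g, u 5\<close>.\<close>
  have plane: "x \<in> span {a, b, q}"
    if ind: "{i, i', f, g} = {1, 2, 3, 4}"
      and ab: "\<And>s. s \<in> S \<Longrightarrow> lorentz a s = 0 \<and> lorentz b s = 0"
      and a: "lorentz a (u i) = 0" "lorentz a (u i') = 0" "lorentz a (u f) \<noteq> 0"
      and b: "lorentz b (u i) = 0" "lorentz b (u i') = 0" "lorentz b (u f) = 0" "lorentz b (u g) \<noteq> 0"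
      and x: "\<And>s. s \<in> S \<Longrightarrow> lorentz x s = 0" "lorentz x (u i) = 0" "lorentz x (u i') = 0"
    for x a b i i' f g
  proof -
    have i: "i \<in> {1, 2, 3, 4}" "i' \<in> {1, 2, 3, 4}" "f \<in> {1, 2, 3, 4}" "g \<in> {1, 2, 3, 4}"
      using ind by blast+
    have q14: "lorentz q (u x) = 0" if "x \<in> {1, 2, 3, 4}" for x
      using qinc[of x] that by auto
    have qi: "lorentz q (u i) = 0" "lorentz q (u i') = 0" "lorentz q (u f) = 0" "lorentz q (u g) = 0"
        "lorentz q (u 5) \<noteq> 0"
      using q14 i qinc[of 5] by simp_all
    have "x \<in> span (fst ` set [(a, u f), (b, u g), (q, u 5)])"
    proof (rule lorentz_triangular)
      show "sorted_wrt (\<lambda>(e, f) (e', f'). lorentz e' f = 0) [(a, u f), (b, u g), (q, u 5)]"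
        using b qi by simp
      show "lorentz e h \<noteq> 0 \<and> (\<forall>s\<in>insert (u i) (insert (u i') S). lorentz e s = 0)"
        if "(e, h) \<in> set [(a, u f), (b, u g), (q, u 5)]" for e h
      proof -
        have "(e, h) = (a, u f) \<or> (e, h) = (b, u g) \<or> (e, h) = (q, u 5)" using that by auto
        then show ?thesis
          by (elim disjE) (use a b qi in \<open>simp_all add: ab q0(2)\<close>)
      qed
      show "y = 0" if y: "\<forall>s\<in>insert (u i) (insert (u i') S). lorentz y s = 0"
        "\<forall>f\<in>snd ` set [(a, u f), (b, u g), (q, u 5)]. lorentz y f = 0" for y
      proof (rule basis)
        fix k :: nat assume "k \<in> {1..5}"
        then have "k \<in> {i, i', f, g} \<or> k = 5" unfolding ind by auto
        then show "lorentz y (u k) = 0" using y by auto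
      qed (use y in auto)
      show "lorentz x s = 0" if "s \<in> insert (u i) (insert (u i') S)" for s
        using that x by blast
    qed
    then show ?thesis by simp
  qed
  have line1: "x \<in> span {P 1 5, z, q}" if "\<And>s. s \<in> S \<Longrightarrow> lorentz x s = 0" "lorentz x (u 1) = 0" "lorentz x (u 2) = 0" for x
    by (rule plane[of 1 2 3 4]) (simp_all add: that Pinc zinc PS[of 1 5] insert_commute del: One_nat_def)
  have line2: "x \<in> span {P 2 5, z, q}" if "\<And>s. s \<in> S \<Longrightarrow> lorentz x s = 0" "lorentz x (u 2) = 0" "lorentz x (u 3) = 0" for x
    by (rule plane[of 2 3 1 4]) (simp_all add: that Pinc zinc PS[of 2 5] insert_commute del: One_nat_def)
  have line2': "x \<in> span {P 2 5, z', q}" if "\<And>s. s \<in> S \<Longrightarrow> lorentz x s = 0" "lorentz x (u 2) = 0" "lorentz x (u 3) = 0" for x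
    by (rule plane[of 2 3 4 1]) (simp_all add: that Pinc z'inc PS[of 2 5] insert_commute del: One_nat_def)
  have line3: "x \<in> span {P 3 5, z', q}" if "\<And>s. s \<in> S \<Longrightarrow> lorentz x s = 0" "lorentz x (u 3) = 0" "lorentz x (u 4) = 0" for x
    by (rule plane[of 3 4 2 1]) (simp_all add: that Pinc z'inc PS[of 3 5] insert_commute del: One_nat_def)
  \<comment> \<open>The two outer lines together span the complement of \<open>S\<close>: the five
    vectors are triangular against \<open>u 3, u 2, u 1, u 4, u 5\<close>.\<close>
  have all: "x \<in> span {P 1 5, P 3 5, z', z, q}" if x: "\<And>s. s \<in> S \<Longrightarrow> lorentz x s = 0" for x
  proof -
    let ?ps = "[(P 1 5, u 3), (P 3 5, u 2), (z', u 1), (z, u 4), (q, u 5)]"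
    have "x \<in> span (fst ` set ?ps)"
    proof (rule lorentz_triangular[OF _ _ _ x])
      show "sorted_wrt (\<lambda>(e, f) (e', f'). lorentz e' f = 0) ?ps"
        by (simp add: Pinc zinc z'inc qinc del: One_nat_def)
      show "lorentz e h \<noteq> 0 \<and> (\<forall>s\<in>S. lorentz e s = 0)" if "(e, h) \<in> set ?ps" for e h
      proof -
        have "(e, h) = (P 1 5, u 3) \<or> (e, h) = (P 3 5, u 2) \<or> (e, h) = (z', u 1) \<or> (e, h) = (z, u 4) \<or> (e, h) = (q, u 5)"
          using that by auto
        then show ?thesis
          by (elim disjE) (simp_all add: Pinc zinc z'inc qinc PS[of 1 5] PS[of 3 5] q0(2) del: One_nat_def)
      qed
      show "y = 0" if y: "\<forall>s\<in>S. lorentz y s = 0" "\<forall>f\<in>snd ` set ?ps. lorentz y f = 0" for y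
      proof (rule basis)
        fix k :: nat assume "k \<in> {1..5}"
        then have "k \<in> {1, 2, 3, 4, 5}" by auto
        then show "lorentz y (u k) = 0" using y(2) by auto
      qed (use y in auto)
    qed
    then show ?thesis by simp
  qed
  have on_line: "P 1 j \<in> span {P 1 5, z, q}" "P 2 j \<in> span {P 2 5, z, q}"
    "P 2 j \<in> span {P 2 5, z', q}" "P 3 j \<in> span {P 3 5, z', q}" if j: "j \<in> {5..9}" for j
  proof -
    show "P 1 j \<in> span {P 1 5, z, q}"
      using PS(1)[of 1 j] Pinc[of 1 j] j by (intro line1) auto
    show "P 2 j \<in> span {P 2 5, z, q}"
      using PS(1)[of 2 j] Pinc[of 2 j] j by (intro line2) auto
    show "P 2 j \<in> span {P 2 5, z', q}"
      using PS(1)[of 2 j] Pinc[of 2 j] j by (intro line2') auto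
    show "P 3 j \<in> span {P 3 5, z', q}"
      using PS(1)[of 3 j] Pinc[of 3 j] j by (intro line3) auto
  qed
  define D where "D = (\<lambda>i. P i 7 - P i 5)"
  define w6 w8 where "w6 = U 7 - U 6" and "w8 = U 9 - U 8"
  have ratio: "lorentz (D 1) w6 * lorentz (D 2) w8 = lorentz (D 2) w6 * lorentz (D 1) w8"
      "lorentz (D 2) w6 * lorentz (D 3) w8 = lorentz (D 3) w6 * lorentz (D 2) w8"
      "lorentz (D 2) w6 \<noteq> 0"
  proof -
    have i: "(1::nat) \<in> {1,2,3}" "(2::nat) \<in> {1,2,3}" "(3::nat) \<in> {1,2,3}" by auto
    note P12 = P0(1)[OF i(1)] P0(2)[OF i(1)] P0(3)[OF i(1)] Pd[OF i(1)] on_line(1)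
      P0(1)[OF i(2)] P0(2)[OF i(2)] P0(3)[OF i(2)] Pd[OF i(2)] on_line(2)
      Uq UP[OF i(1)] UP[OF i(2)]
    note P23 = P0(1)[OF i(2)] P0(2)[OF i(2)] P0(4)[OF i(2)] Pd[OF i(2)] on_line(3)
      P0(1)[OF i(3)] P0(2)[OF i(3)] P0(4)[OF i(3)] Pd[OF i(3)] on_line(4)
      Uq UP[OF i(2)] UP[OF i(3)]
    show "lorentz (D 1) w6 * lorentz (D 2) w8 = lorentz (D 2) w6 * lorentz (D 1) w8"
      unfolding D_def w6_def w8_def by (rule two_lines(1)[OF q0(1) z0(1,2) P12])
    show "lorentz (D 2) w6 * lorentz (D 3) w8 = lorentz (D 3) w6 * lorentz (D 2) w8"
      unfolding D_def w6_def w8_def by (rule two_lines(1)[OF q0(1) z0(3,4) P23])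
    show "lorentz (D 2) w6 \<noteq> 0"
      unfolding D_def w6_def w8_def by (rule two_lines(2)[OF q0(1) z0(3,4) P23])
  qed
  \<comment> \<open>The combination of the two plane normals that kills \<open>D 2\<close>; the
    ratio identities make it kill \<open>D 1\<close> and \<open>D 3\<close> as well.\<close>
  define w where "w = lorentz (D 2) w8 *\<^sub>R w6 - lorentz (D 2) w6 *\<^sub>R w8"
  have wD: "lorentz (D i) w = 0" if "i \<in> {1,2,3}" for i
    using that ratio(1,2) by (auto simp: w_def lorentz_linear algebra_simps)
  have qw: "lorentz q w = 0"
    using Uq[of 6] Uq[of 7] Uq[of 8] Uq[of 9] lorentz_commute[of q]
    by (simp add: w_def w6_def w8_def lorentz_linear)
  \<comment> \<open>The multiple of \<open>q\<close> makes \<open>y\<close> orthogonal to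
    \<open>z\<close>; the products with \<open>q\<close> and with each \<open>D i\<close> remain
    0.\<close>
  define y where "y = w - lorentz z w *\<^sub>R q"
  have y: "lorentz q y = 0" "lorentz z y = 0"
    using qw q0 z0 by (simp_all add: y_def lorentz_linear)
  have yD: "lorentz (D i) y = 0" if "i \<in> {1,2,3}" for i
    using wD[OF that] P0(2)[of i 5] P0(2)[of i 7] that by (simp add: y_def D_def lorentz_linear)
  \<comment> \<open>\<open>y\<close> is orthogonal to a finite point \<open>x\<close> of the line,
    to \<open>q\<close> and to the direction. A nonzero product with \<open>P i 5\<close> would
    force \<open>P i 7 = P i 5\<close>.\<close>
  have y5: "lorentz (P i 5) y = 0"
    if i: "i \<in> {1,2,3}" and x: "P i 7 \<in> span {P i 5, x, q}" "lorentz x x = 0" "lorentz x q = 1" "lorentz x y = 0"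
    for i x
  proof (rule ccontr)
    assume ne: "lorentz (P i 5) y \<noteq> 0"
    obtain r s t where rst: "P i 7 = r *\<^sub>R P i 5 + s *\<^sub>R x + t *\<^sub>R q"
      using x(1) by (rule span3E)
    have "lorentz (P i 7) y = lorentz (P i 5) y"
      using yD[OF i] by (simp add: D_def lorentz_linear)
    then have r: "r = 1" using ne x(4) y by (simp add: rst lorentz_linear)
    have "r + s = 1"
      using P0(2)[OF i, of 5] P0(2)[OF i, of 7] x(3) q0 by (simp add: rst lorentz_linear)
    then have "s = 0" using r by simp
    then have "lorentz (P i 7) (P i 7) = 2 * t"
      using r P0(1,2)[OF i, of 5] q0 lorentz_commute[of q "P i 5"] by (simp add: rst lorentz_linear)
    then have "P i 7 = P i 5"
      using P0(1)[OF i, of 7] rst r \<open>s = 0\<close> by simp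
    then show False using Pd[OF i, of 5 7] P0(1)[OF i, of 5] by simp
  qed
  have "lorentz (P 1 5) y = 0"
    by (rule y5[OF _ on_line(1) z0(1,2) y(2)]) auto
  have "lorentz (P 2 5) y = 0"
    by (rule y5[OF _ on_line(2) z0(1,2) y(2)]) auto
  have "z' \<in> span {P 2 5, z, q}"
    using PS(3)[of 1 5] z'inc by (intro line2) auto
  then have "lorentz y z' = 0"
    by (rule lorentz_span) (use y \<open>lorentz (P 2 5) y = 0\<close> in \<open>auto simp: lorentz_commute[of y]\<close>)
  then have "lorentz (P 3 5) y = 0"
    using lorentz_commute[of y z'] by (intro y5[OF _ on_line(4) z0(3,4)]) auto
  have "y \<in> span S"
  proof (rule span_if_lorentz_orthogonal)
    fix x assume x: "\<And>s. s \<in> S \<Longrightarrow> lorentz x s = 0"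
    have "lorentz y g = 0" if "g \<in> {P 1 5, P 3 5, z', z, q}" for g
      using that \<open>lorentz (P 1 5) y = 0\<close> \<open>lorentz (P 3 5) y = 0\<close> \<open>lorentz y z' = 0\<close> y
        lorentz_commute[of y g] by auto
    with all[OF x] have "lorentz y x = 0" by (rule lorentz_span)
    then show "lorentz x y = 0" by (simp add: lorentz_commute)
  qed
  \<comment> \<open>The common point \<open>p 6 8\<close> of the two parallel planes is orthogonal
    to both \<open>w\<close> and \<open>y\<close>, so their difference, a multiple of
    \<open>q\<close>, must vanish.\<close>
  have "lorentz (p 6 8) y = 0"
    using \<open>y \<in> span S\<close> by (rule lorentz_span) (use S in auto)
  moreover have "lorentz (p 6 8) w = 0"
    using inc[of 6 8 6] inc[of 6 8 7] inc[of 6 8 8] inc[of 6 8 9] by (simp add: w_def w6_def w8_def U_def Nr lorentz_linear)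
  ultimately have "lorentz z w * lorentz (p 6 8) q = 0"
    by (simp add: y_def lorentz_linear)
  then have "lorentz z w = 0" using qp[of 6 8] by simp
  then have w: "w \<in> span S" using \<open>y \<in> span S\<close> by (simp add: y_def)
  let ?X = "insert (u 6) (insert (u 7) (insert (u 8) S))"
  have "U 6 \<in> span ?X" "U 7 \<in> span ?X" "U 8 \<in> span ?X"
    unfolding U_def N_def by (intro span_scale span_base; simp)+
  moreover have "w \<in> span ?X" using w span_mono[of S ?X] by blast
  \<comment> \<open>Solves the definition of \<open>w\<close> for \<open>U 9\<close>, whose
    coefficient is nonzero, and undoes the normalization.\<close>
  moreover have "u 9 = (lorentz (u 9) q / lorentz (D 2) w6) *\<^sub>R (lorentz (D 2) w8 *\<^sub>R (U 7 - U 6) + lorentz (D 2) w6 *\<^sub>R U 8 - w)"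
    using ratio(3) qu[of 9] by (simp add: w_def w6_def w8_def algebra_simps) (simp add: U_def N_def)
  ultimately have "u 9 \<in> span ?X"
    by (metis (no_types, lifting) span_add span_diff span_scale)
  then show False using indep by blast
qed

subsection \<open>Faces of the cyclic polytope\<close>

text \<open>The linear functional with coefficients of such a polynomial \<open>g\<close> supports the cyclic polytope
  exactly along the vertices with index in \<open>A\<close>. Building \<open>g\<close> from an initial block, squares and
  pairs of consecutive factors is Gale's evenness condition.\<close>

definition gale_face :: "nat \<Rightarrow> nat \<Rightarrow> nat set \<Rightarrow> bool" where
  "gale_face n r A \<longleftrightarrow> (\<forall>t::nat \<Rightarrow> real. strict_mono_on {..<n} t \<longrightarrow>
     (\<exists>g. degree g \<le> r \<and> (\<forall>i<n. 0 \<le> poly g (t i) \<and> (poly g (t i) = 0 \<longleftrightarrow> i \<in> A))))"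

lemma gale_face_mono: "gale_face n r A \<Longrightarrow> r \<le> r' \<Longrightarrow> gale_face n r' A"
  unfolding gale_face_def by (meson order_trans)

lemma gale_face_initial: "gale_face n m {..<m}"
  unfolding gale_face_def
proof (intro allI impI)
  fix t :: "nat \<Rightarrow> real" assume t: "strict_mono_on {..<n} t"
  define g where "g = (\<Prod>j<m. [:- t j, 1:])"
  have "degree g \<le> (\<Sum>j<m. degree [:- t j, 1:])"
    unfolding g_def by (rule order_trans[OF degree_prod_sum_le]) (auto intro: sum_mono)
  then have "degree g \<le> m" by simp
  moreover have "0 \<le> poly g (t i) \<and> (poly g (t i) = 0 \<longleftrightarrow> i \<in> {..<m})" if "i < n" for i
  proof (cases "i < m")
    case True
    then have "poly g (t i) = 0" by (auto simp: g_def poly_prod)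
    then show ?thesis using True by simp
  next
    case False
    then have "t j < t i" if "j < m" for j
      using strict_mono_onD[OF t, of j i] \<open>i < n\<close> that by auto
    then have "0 < poly g (t i)"
      unfolding g_def poly_prod by (intro prod_pos) auto
    then show ?thesis using False by simp
  qed
  ultimately show "\<exists>g. degree g \<le> m \<and> (\<forall>i<n. 0 \<le> poly g (t i) \<and> (poly g (t i) = 0 \<longleftrightarrow> i \<in> {..<m}))"
    by blast
qed

lemma gale_face_multiply:
  assumes "gale_face n r A"
    and h: "\<And>t::nat \<Rightarrow> real. strict_mono_on {..<n} t \<Longrightarrow> \<exists>h. degree h \<le> s \<and>
      (\<forall>i<n. 0 \<le> poly h (t i) \<and> (poly h (t i) = 0 \<longleftrightarrow> i \<in> B))"
  shows "gale_face n (r + s) (A \<union> B)"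
  unfolding gale_face_def
proof (intro allI impI)
  fix t :: "nat \<Rightarrow> real" assume t: "strict_mono_on {..<n} t"
  obtain g where g: "degree g \<le> r" "\<And>i. i < n \<Longrightarrow> 0 \<le> poly g (t i) \<and> (poly g (t i) = 0 \<longleftrightarrow> i \<in> A)"
    using assms(1) t unfolding gale_face_def by blast
  obtain h where h: "degree h \<le> s" "\<And>i. i < n \<Longrightarrow> 0 \<le> poly h (t i) \<and> (poly h (t i) = 0 \<longleftrightarrow> i \<in> B)"
    using h t by blast
  have "degree (g * h) \<le> r + s"
    using g(1) h(1) degree_mult_le[of g h] by linarith
  moreover have "0 \<le> poly (g * h) (t i) \<and> (poly (g * h) (t i) = 0 \<longleftrightarrow> i \<in> A \<union> B)" if "i < n" for i
    using g(2)[OF that] h(2)[OF that] by auto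
  ultimately show "\<exists>g. degree g \<le> r + s \<and> (\<forall>i<n. 0 \<le> poly g (t i) \<and> (poly g (t i) = 0 \<longleftrightarrow> i \<in> A \<union> B))"
    by blast
qed

lemma gale_face_insert:
  assumes "gale_face n r A" "a < n"
  shows "gale_face n (r + 2) (insert a A)"
proof -
  have "\<exists>h. degree h \<le> 2 \<and> (\<forall>i<n. 0 \<le> poly h (t i) \<and> (poly h (t i) = 0 \<longleftrightarrow> i \<in> {a}))"
    if t: "strict_mono_on {..<n} t" for t :: "nat \<Rightarrow> real"
  proof (intro exI conjI allI impI)
    show "degree ([:- t a, 1:]^2) \<le> 2" by (simp add: degree_power_eq)
    show "0 \<le> poly ([:- t a, 1:]^2) (t i)" for i by simp
    show "poly ([:- t a, 1:]^2) (t i) = 0 \<longleftrightarrow> i \<in> {a}" if "i < n" for i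
      using strict_mono_on_imp_inj_on[OF t] \<open>a < n\<close> that by (auto simp: inj_on_def)
  qed
  from gale_face_multiply[OF assms(1) this] show ?thesis by simp
qed

text \<open>The quadratic is negative only strictly between two consecutive parameters, where no
  other parameter lies.\<close>

lemma gale_face_insert_pair:
  assumes "gale_face n r A" "a + 1 < n"
  shows "gale_face n (r + 2) (insert a (insert (a + 1) A))"
proof -
  have "\<exists>h. degree h \<le> 2 \<and> (\<forall>i<n. 0 \<le> poly h (t i) \<and> (poly h (t i) = 0 \<longleftrightarrow> i \<in> {a, a + 1}))"
    if t: "strict_mono_on {..<n} t" for t :: "nat \<Rightarrow> real"
  proof (intro exI conjI allI impI)
    let ?h = "[:- t a, 1:] * [:- t (a + 1), 1:]"
    show "degree ?h \<le> 2" by (rule order_trans[OF degree_mult_le]) simp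
    have less: "t i < t j" if "i < j" "j < n" for i j
      using strict_mono_onD[OF t, of i j] that by auto
    have h: "poly ?h x = (x - t a) * (x - t (a + 1))" for x
      by (simp add: algebra_simps)
    show "0 \<le> poly ?h (t i)" if "i < n" for i
    proof (cases "i \<le> a")
      case True
      then have "t i \<le> t a" "t i \<le> t (a + 1)"
        using less[of i a] less[of i "a + 1"] assms(2) by (cases "i = a"; simp)+
      then show ?thesis unfolding h by (intro mult_nonpos_nonpos) auto
    next
      case False
      then have "t a \<le> t i" "t (a + 1) \<le> t i"
        using less[of a i] less[of "a + 1" i] that by (cases "i = a + 1"; simp)+
      then show ?thesis unfolding h by simp
    qed
    show "poly ?h (t i) = 0 \<longleftrightarrow> i \<in> {a, a + 1}" if "i < n" for i
      unfolding h using strict_mono_on_imp_inj_on[OF t] assms(2) that by (auto simp: inj_on_def)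
  qed
  from gale_face_multiply[OF assms(1) this] show ?thesis by (simp add: insert_commute)
qed

section \<open>Contradictions for the vertices of a scribed realization\<close>

text \<open>The interface between the geometry of a realization and the two algebraic
  contradictions. \<open>outside_face\<close> holds because the span of a face meets the cone only
  in that face.\<close>

locale scribed_cyclic_vertices =
  fixes n k :: nat and v :: "nat \<Rightarrow> real \<times> (real ^ 'd::finite)"
  assumes outside_face: "\<And>A j. gale_face n CARD('d) A \<Longrightarrow> A \<subseteq> {..<n} \<Longrightarrow> j < n \<Longrightarrow> j \<notin> A \<Longrightarrow>
      v j \<notin> span (v ` A)"
    and tangent: "\<And>A. gale_face n CARD('d) A \<Longrightarrow> A \<subseteq> {..<n} \<Longrightarrow> card A = k + 1 \<Longrightarrow>
      inj_on v A \<Longrightarrow> independent (v ` A) \<Longrightarrow> tangent_vectors (v ` A)"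
begin

lemma outside_span:
  assumes "gale_face n r A" "r \<le> CARD('d)" "A \<subseteq> {..<n}" "j < n" "j \<notin> A"
  shows "v j \<notin> span (v ` A)"
  using outside_face[OF gale_face_mono[OF assms(1,2)] assms(3-5)] .

text \<open>Independence grows along a chain of Gale faces, each new vertex lying outside the span
  of the face before it. The last set of the chain may be one vertex larger than a facet.\<close>

lemma independent_insert_face:
  assumes "inj_on v A \<and> independent (v ` A)" "gale_face n r A" "r \<le> CARD('d)" "A \<subseteq> {..<n}" "j < n" "j \<notin> A"
  shows "inj_on v (insert j A) \<and> independent (v ` insert j A)"
  using assms(1) outside_span[OF assms(2-6)] span_base[of "v j" "v ` A"] by (auto simp: independent_insert)

lemma independent_initial:
  assumes "m \<le> CARD('d) + 1" "m \<le> n"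
  shows "inj_on v {..<m} \<and> independent (v ` {..<m})"
  using assms
proof (induction m)
  case 0 then show ?case by (simp add: independent_empty)
next
  case (Suc m)
  then show ?case
    using independent_insert_face[OF _ gale_face_initial, of m m] by (auto simp: lessThan_Suc)
qed

lemma span_initial:
  assumes "CARD('d) + 1 \<le> n"
  shows "span (v ` {..<CARD('d) + 1}) = UNIV"
proof -
  have "card (v ` {..<CARD('d) + 1}) = DIM(real \<times> (real ^ 'd))"
    using independent_initial[of "CARD('d) + 1"] assms by (simp add: card_image)
  then show ?thesis
    using independent_initial[of "CARD('d) + 1"] assms
    by (metis dim_eq_card_independent dim_eq_full order_refl)
qed

lemma tangent_face:
  assumes "gale_face n r A" "r \<le> CARD('d)" "A \<subseteq> {..<n}" "card A = k + 1" "inj_on v A \<and> independent (v ` A)"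
  shows "tangent_vectors (v ` A)"
  using tangent[OF gale_face_mono[OF assms(1,2)]] assms by blast

lemma no_scribed_low:
  assumes k: "1 \<le> k" "k + 2 \<le> CARD('d)" and d4: "4 \<le> CARD('d)" and n: "CARD('d) + 4 \<le> n"
  shows False
proof -
  define d where "d = CARD('d)"
  have kd: "k + 2 \<le> d" "4 \<le> d" and nd: "d + 4 \<le> n" using k n d4 by (auto simp: d_def)
  \<comment> \<open>With \<open>d + 1\<close> or \<open>d + 3\<close>, the vertex
    \<open>d + 2\<close> forms a consecutive pair, so either extension of \<open>I\<close> costs
    degree \<open>k\<close> and a further double root at \<open>j\<close> costs
    \<open>k + 2\<close>. For \<open>k = 1\<close> the set is empty and two double roots cost 4.
    Both are at most \<open>d\<close>.\<close>
  define I where "I = {..<k - 2} \<union> (if k = 1 then {} else {d + 2})"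
  define J where "J = {k - 2..d}"
  have I: "I \<subseteq> {..<n}" "finite I" "card I = k - 1" "\<And>a. a \<in> {d + 1, d + 3} \<union> J \<Longrightarrow> a \<notin> I"
    using kd nd k(1) by (auto simp: I_def J_def)
  have Jn: "j < n" if "j \<in> J" for j using that nd by (auto simp: J_def)
  note up = gale_face_mono[where r' = d]
  have face: "gale_face n d I \<and> gale_face n d (insert x I) \<and>
      gale_face n d (insert j I) \<and> gale_face n d (insert j (insert x I))"
    if x: "x \<in> {d + 1, d + 3}" and j: "j \<in> J" for x j
  proof (cases "k = 1")
    case True
    then have I0: "I = {..<0}" by (auto simp: I_def)
    have x': "gale_face n (0 + 2) (insert x I)" and j': "gale_face n (0 + 2) (insert j I)"
      unfolding I0 using x nd Jn[OF j] by (intro gale_face_insert[OF gale_face_initial]; auto)+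
    have "gale_face n (0 + 2 + 2) (insert j (insert x I))"
      by (rule gale_face_insert[OF x' Jn[OF j]])
    then show ?thesis
      using up[OF x'] up[OF j'] up[of n 0 I] kd gale_face_initial[of n 0] up by (auto simp: I0)
  next
    case False
    then have I2: "I = insert (d + 2) {..<k - 2}" and k2: "k - 2 + 2 = k"
      using k by (auto simp: I_def)
    have 1: "gale_face n k I"
      using gale_face_insert[OF gale_face_initial, of "d + 2" n "k - 2"] nd k2 by (simp add: I2)
    have "insert x I = insert (d + 1) (insert (d + 1 + 1) {..<k - 2}) \<or>
      insert x I = insert (d + 2) (insert (d + 2 + 1) {..<k - 2})"
      using x by (auto simp: I2)
    then have 2: "gale_face n k (insert x I)"
      using gale_face_insert_pair[OF gale_face_initial, of "d + 1" n "k - 2"]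
        gale_face_insert_pair[OF gale_face_initial, of "d + 2" n "k - 2"] nd k2 by auto
    show ?thesis
      using up[OF 1] up[OF 2] up[OF gale_face_insert[OF 1 Jn[OF j]]] up[OF gale_face_insert[OF 2 Jn[OF j]]] kd
      by simp
  qed
  have J0: "d \<in> J" using kd by (auto simp: J_def)
  have indep: "inj_on v (insert x I) \<and> independent (v ` insert x I)" if x: "x \<in> {d + 1, d + 3}" for x
  proof -
    have "inj_on v {..<k - 2} \<and> independent (v ` {..<k - 2})"
      using independent_initial[of "k - 2"] kd nd by (simp add: d_def)
    then have "inj_on v I \<and> independent (v ` I)"
      using independent_insert_face[OF _ gale_face_initial, of "k - 2" "d + 2"] kd nd by (auto simp: I_def d_def)
    then show ?thesis
      using independent_insert_face[of I d x] face[OF x J0] x nd I by (auto simp: d_def)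
  qed
  show False
  proof (rule no_two_tangent_pencils[of "v ` I" "v ` J" "v (d + 1)" "v (d + 3)"])
    show "finite (v ` I)" "v ` J \<noteq> {}" using I J0 by auto
    \<comment> \<open>\<open>J\<close> starts where the initial block of \<open>I\<close> ends, so
      together they contain the first \<open>d + 1\<close> vertices, a basis.\<close>
    have "{..<d + 1} \<subseteq> I \<union> J"
      by (auto simp: I_def J_def)
    then have "v ` {..<d + 1} \<subseteq> v ` I \<union> v ` J" by blast
    then show "span (v ` I \<union> v ` J) = UNIV"
      using span_mono[of "v ` {..<d + 1}" "v ` I \<union> v ` J"] span_initial nd unfolding d_def by (simp add: top.extremum_unique del: image_Un)
    have xj: "tangent_vectors (v ` insert x (insert j I)) \<and> v j \<notin> span (v ` insert x I) \<and> v x \<notin> span (v ` insert j I)"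
      if x: "x \<in> {d + 1, d + 3}" and j: "j \<in> J" for x j
    proof (intro conjI)
      have ne: "j \<noteq> x" "x < n" using x j nd by (auto simp: J_def)
      show 1: "v j \<notin> span (v ` insert x I)"
        using face[OF x j] ne Jn[OF j] I(1) I(4)[of j] j by (intro outside_span[of d]) (auto simp: d_def)
      show "v x \<notin> span (v ` insert j I)"
        using face[OF x j] ne Jn[OF j] I(1) I(4)[of x] x by (intro outside_span[of d]) (auto simp: d_def)
      have "inj_on v (insert j (insert x I)) \<and> independent (v ` insert j (insert x I))"
        using face[OF x j] ne Jn[OF j] I(1) I(4)[of j] j
        by (intro independent_insert_face[OF indep[OF x], of d]) (auto simp: d_def)
      moreover have "card (insert j (insert x I)) = k + 1"
        using I ne I(4)[of x] I(4)[of j] x j k by auto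
      ultimately have "tangent_vectors (v ` insert j (insert x I))"
        using face[OF x j] ne Jn[OF j] I(1) by (intro tangent_face[of d]) (auto simp: d_def)
      then show "tangent_vectors (v ` insert x (insert j I))" by (simp add: insert_commute)
    qed
    show "tangent_vectors (insert x (insert j (v ` I)))" "j \<notin> span (insert x (v ` I))" "x \<notin> span (insert j (v ` I))"
      if "x \<in> {v (d + 1), v (d + 3)}" "j \<in> v ` J" for x j
      using xj that by auto
    show "v (d + 3) \<notin> span (insert (v (d + 1)) (v ` I))"
      using outside_span[of d "insert (d + 1) I" "d + 3"] face[of "d + 1" d] J0 nd I(1) I(4)[of "d + 3"]
      by (auto simp: d_def)
  qed
qed

text \<open>An initial block of \<open>d - 4\<close> vertices and two consecutive pairs use exactly
  degree \<open>d\<close>. The bound \<open>d + 7\<close> on \<open>n\<close> provides the eleven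
  vertices \<open>u 0, ..., u 10\<close> after the block.\<close>

lemma no_scribed_facets:
  assumes k: "k + 1 = CARD('d)" and d4: "4 \<le> CARD('d)" and n: "CARD('d) + 7 \<le> n"
  shows False
proof -
  define d m where "d = CARD('d)" and "m = d - 4"
  have nd: "d + 7 \<le> n" and md: "d = m + 4" and kd: "k + 1 = d" using k n d4 by (auto simp: d_def m_def)
  define F where "F = (\<lambda>i j. insert (m + j) (insert (m + j + 1) (insert (m + i) (insert (m + i + 1) {..<m}))))"
  have F1: "gale_face n (m + 2) (insert (m + i) (insert (m + i + 1) {..<m}))" if "i \<le> 9" for i
    using that nd md by (intro gale_face_insert_pair gale_face_initial) auto
  have F2: "gale_face n (m + 2 + 2) (F i j)" if "i \<le> 9" "j \<le> 9" for i j
    unfolding F_def using that nd md by (intro gale_face_insert_pair F1) auto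
  have Fn: "F i j \<subseteq> {..<n}" if "i \<le> 9" "j \<le> 9" for i j
    using that nd md by (auto simp: F_def)
  \<comment> \<open>Each pair is entered through its upper vertex as a double root, and the lower
    vertex completes it at the same degree; every set before the last insertion thus stays a
    face.\<close>
  have indepF: "inj_on v (F i j) \<and> independent (v ` F i j)" if ij: "i + 2 \<le> j" "j \<le> 9" for i j
  proof -
    have ins1: "gale_face n (m + 2) (insert (m + i + 1) {..<m})" if "i \<le> 9" for i
      using that nd md by (intro gale_face_insert gale_face_initial) auto
    have ins2: "gale_face n (m + 2 + 2) (insert (m + j + 1) (insert (m + i) (insert (m + i + 1) {..<m})))"
      using ij nd md by (intro gale_face_insert F1) auto
    have "inj_on v {..<m} \<and> independent (v ` {..<m})"
      using independent_initial[of m] nd md by (simp add: d_def)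
    then have "inj_on v (insert (m + i + 1) {..<m}) \<and> independent (v ` insert (m + i + 1) {..<m})"
      using ij nd md by (intro independent_insert_face[OF _ gale_face_initial]) (auto simp: d_def)
    then have "inj_on v (insert (m + i) (insert (m + i + 1) {..<m})) \<and>
        independent (v ` insert (m + i) (insert (m + i + 1) {..<m}))"
      using ij nd md by (intro independent_insert_face[OF _ ins1]) (auto simp: d_def)
    then have "inj_on v (insert (m + j + 1) (insert (m + i) (insert (m + i + 1) {..<m}))) \<and>
        independent (v ` insert (m + j + 1) (insert (m + i) (insert (m + i + 1) {..<m})))"
      using ij nd md by (intro independent_insert_face[OF _ F1]) (auto simp: d_def)
    then show ?thesis
      unfolding F_def using ij nd md by (intro independent_insert_face[OF _ ins2]) (auto simp: d_def)
  qed
  have cardF: "card (F i j) = d" if ij: "i + 2 \<le> j" "j \<le> 9" for i j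
    using ij md by (simp add: F_def)
  have "\<exists>p. p \<noteq> 0 \<and> lorentz p p = 0 \<and> (\<forall>x\<in>F i j. lorentz p (v x) = 0)" if ij: "i + 2 \<le> j" "j \<le> 9" for i j
  proof -
    have "tangent_vectors (v ` F i j)"
      using indepF[OF ij] cardF[OF ij] F2[of i j] Fn[of i j] ij kd md
      by (intro tangent_face[of "m + 2 + 2"]) (auto simp: d_def)
    then obtain p where "p \<noteq> 0" "lorentz p p = 0" "\<And>x. x \<in> span (v ` F i j) \<Longrightarrow> lorentz p x = 0"
      by (rule tangent_vectorsE) blast
    then show ?thesis by (intro exI[of _ p]) (simp add: span_base)
  qed
  then obtain p where p: "\<And>i j. i + 2 \<le> j \<Longrightarrow> j \<le> 9 \<Longrightarrow>
      p i j \<noteq> 0 \<and> lorentz (p i j) (p i j) = 0 \<and> (\<forall>x\<in>F i j. lorentz (p i j) (v x) = 0)"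
    by metis
  have full: "span (v ` insert x (F i j)) = UNIV" if ij: "i + 2 \<le> j" "j \<le> 9" and x: "x < n" "x \<notin> F i j" for i j x
  proof -
    have ind: "inj_on v (insert x (F i j)) \<and> independent (v ` insert x (F i j))"
      using indepF[OF ij] F2[of i j] Fn[of i j] ij md x
      by (intro independent_insert_face[of _ "m + 2 + 2"]) (auto simp: d_def)
    moreover have "card (insert x (F i j)) = d + 1"
      using cardF[OF ij] x by (simp add: F_def)
    ultimately have "card (v ` insert x (F i j)) = DIM(real \<times> (real ^ 'd))"
      using card_image[of v "insert x (F i j)"] ind by (simp add: d_def del: image_insert)
    then show ?thesis
      using ind by (metis dim_eq_card_independent dim_eq_full)
  qed
  \<comment> \<open>A facet and one vertex outside it span the whole space, so a tangent point
    orthogonal to such a vertex would be zero.\<close>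
  have inc: "lorentz (p i j) (v x) = 0 \<longleftrightarrow> x \<in> F i j" if ij: "i + 2 \<le> j" "j \<le> 9" and x: "x < n" for i j x
  proof
    assume 0: "lorentz (p i j) (v x) = 0"
    show "x \<in> F i j"
    proof (rule ccontr)
      assume "x \<notin> F i j"
      then have "p i j = 0"
        by (rule lorentz_nondegenerate[OF full[OF ij x]]) (use p[OF ij] 0 in auto)
      then show False using p[OF ij] by blast
    qed
  qed (use p[OF ij] in blast)
  show False
  proof (rule no_tangent_facets[where S = "v ` {..<m}" and u = "\<lambda>i. v (m + i)" and p = p])
    show "lorentz (p i j) (p i j) = 0" if "i + 2 \<le> j" "j \<le> 9" for i j
      using p[OF that] by blast
    show "lorentz (p i j) s = 0" if "i + 2 \<le> j" "j \<le> 9" "s \<in> v ` {..<m}" for i j s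
      using p[OF that(1,2)] that(3) by (auto simp: F_def)
    show "lorentz (p i j) (v (m + x)) = 0 \<longleftrightarrow> x \<in> {i, i + 1, j, j + 1}"
      if "i + 2 \<le> j" "j \<le> 9" "x \<le> 10" for i j x
      using inc[OF that(1,2), of "m + x"] that(3) nd md by (auto simp: F_def)
    show "z = 0" if z: "\<And>s. s \<in> v ` {..<m} \<Longrightarrow> lorentz z s = 0" "\<And>x. x \<in> {1..5} \<Longrightarrow> lorentz z (v (m + x)) = 0" for z
    proof (rule lorentz_nondegenerate)
      show "span (v ` insert (m + 5) (F 1 3)) = UNIV"
        using nd md by (intro full) (auto simp: F_def)
      have "x < m \<or> (\<exists>y\<in>{1..5}. x = m + y)" if "x \<in> insert (m + 5) (F 1 3)" for x
        using that by (auto simp: F_def)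
      note split = this
      show "lorentz z s = 0" if s: "s \<in> v ` insert (m + 5) (F 1 3)" for s
      proof -
        obtain x where x: "x \<in> insert (m + 5) (F 1 3)" "s = v x" using s by blast
        then consider "x < m" | y where "y \<in> {1..5}" "x = m + y"
          using split by blast
        then show ?thesis
          by cases (use x z in simp_all)
      qed
    qed
    let ?A = "insert (m + 8) (insert (m + 6) (insert (m + 6 + 1) {..<m}))"
    have "v (m + 9) \<notin> span (v ` ?A)"
      using nd md by (intro outside_span[OF gale_face_insert[OF F1]]) (auto simp: d_def)
    moreover have "m + 6 + 1 = m + 7" by simp
    ultimately show "v (m + 9) \<notin> span (insert (v (m + 6)) (insert (v (m + 7)) (insert (v (m + 8)) (v ` {..<m}))))"
      by (simp only: image_insert insert_commute not_False_eq_True)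
  qed
qed

end

section \<open>Supporting hyperplanes from polynomials\<close>

text \<open>The exponents of the moment curve are the ranks of the indices; sums over coordinates
  become sums over degrees.\<close>

lemma card_atMost_bij: "bij_betw (\<lambda>i::'d::{finite,linorder}. card {j. j \<le> i}) UNIV {1..CARD('d)}"
proof -
  have mono: "card {j. j \<le> a} < card {j. j \<le> b}" if "a < b" for a b :: 'd
  proof (intro psubset_card_mono psubsetI)
    show "{j. j \<le> a} \<noteq> {j. j \<le> b}" using that by (metis leD mem_Collect_eq order_refl)
  qed (use that in auto)
  have "inj (\<lambda>i::'d. card {j. j \<le> i})"
    by (rule injI) (metis mono linorder_less_linear order_less_irrefl)
  moreover have "range (\<lambda>i::'d. card {j. j \<le> i}) \<subseteq> {1..CARD('d)}"
  proof clarsimp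
    fix i :: 'd
    have "0 < card {j. j \<le> i}" by (subst card_gt_0_iff) auto
    then show "Suc 0 \<le> card {j. j \<le> i} \<and> card {j. j \<le> i} \<le> CARD('d)" by (simp add: card_mono)
  qed
  ultimately show ?thesis
    unfolding bij_betw_def by (intro conjI card_subset_eq) (simp_all add: card_image)
qed

lemma poly_moment_curve:
  fixes g :: "real poly"
  assumes "degree g \<le> CARD('d)"
  shows "\<exists>a. \<forall>t. poly g t = coeff g 0 + a \<bullet> (moment_curve t :: real ^ 'd::{finite,linorder})"
proof (intro exI allI)
  fix t
  have "poly g t = (\<Sum>m\<le>CARD('d). coeff g m * t ^ m)"
    unfolding poly_altdef using assms
    by (intro sum.mono_neutral_left) (auto simp: coeff_eq_0)
  also have "{..CARD('d)} = insert 0 {1..CARD('d)}" by auto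
  also have "(\<Sum>m\<in>insert 0 {1..CARD('d)}. coeff g m * t ^ m) = coeff g 0 + (\<Sum>m\<in>{1..CARD('d)}. coeff g m * t ^ m)"
    by simp
  also have "(\<Sum>m\<in>{1..CARD('d)}. coeff g m * t ^ m) =
      (\<Sum>i\<in>(UNIV::'d set). coeff g (card {j. j \<le> i}) * t ^ card {j. j \<le> i})"
    by (rule sum.reindex_bij_betw[OF card_atMost_bij, symmetric])
  finally show "poly g t = coeff g 0 + (\<chi> i. coeff g (card {j. j \<le> i})) \<bullet> (moment_curve t :: (real, 'd) vec)"
    by (simp add: moment_curve_def inner_vec_def)
qed

text \<open>\<open>x i\<close> is the vertex at the \<open>i\<close>-th smallest parameter. A Gale
  polynomial, read as an affine functional on the moment curve, cuts out the required face; a double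
  root at one parameter isolates a vertex.\<close>

lemma cyclic_polytope_faces:
  fixes C :: "(real ^ 'd::{finite,linorder}) set"
  assumes C: "cyclic_polytope n C" and d: "2 \<le> CARD('d)"
  obtains x :: "nat \<Rightarrow> (real, 'd) vec" where
    "\<And>i. i < n \<Longrightarrow> {x i} face_of C"
    "\<And>A. gale_face n CARD('d) A \<Longrightarrow> \<exists>F. F face_of C \<and> (\<forall>i<n. x i \<in> F \<longleftrightarrow> i \<in> A)"
    "\<And>F. F face_of C \<Longrightarrow> F \<noteq> {} \<Longrightarrow> \<exists>i<n. x i \<in> F"
proof -
  obtain T where T: "finite T" "card T = n" "C = convex hull (moment_curve ` T)"
    using C unfolding cyclic_polytope_def by blast
  define t where "t = (\<lambda>i. sorted_list_of_set T ! i)"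
  have t: "strict_mono_on {..<n} t"
  proof (rule strict_mono_onI)
    fix i j assume "i \<in> {..<n}" "j \<in> {..<n}" "i < j"
    then show "t i < t j"
      unfolding t_def using sorted_wrt_nth_less[OF strict_sorted_list_of_set[of T], of i j] T by simp
  qed
  have tT: "t ` {..<n} = T"
    using nth_image[of n "sorted_list_of_set T"] T by (simp add: t_def[abs_def] atLeast0LessThan)
  define x where "x = (\<lambda>i. moment_curve (t i) :: (real, 'd) vec)"
  have CX: "C = convex hull (x ` {..<n})"
    unfolding T(3) tT[symmetric] x_def by (simp add: image_image)
  have comp: "compact (x ` {..<n})" by (simp add: finite_imp_compact)
  have face: "\<exists>F. F face_of C \<and> (\<forall>i<n. x i \<in> F \<longleftrightarrow> i \<in> A)" if A: "gale_face n CARD('d) A" for A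
  proof -
    obtain g where g: "degree g \<le> CARD('d)" "\<And>i. i < n \<Longrightarrow> 0 \<le> poly g (t i) \<and> (poly g (t i) = 0 \<longleftrightarrow> i \<in> A)"
      using A t unfolding gale_face_def by blast
    obtain a where a: "\<And>t. poly g t = coeff g 0 + a \<bullet> (moment_curve t :: (real, 'd) vec)"
      using poly_moment_curve[OF g(1)] by blast
    let ?F = "C \<inter> {y. a \<bullet> y = - coeff g 0}"
    have "C \<subseteq> {y. a \<bullet> y \<ge> - coeff g 0}"
      unfolding CX using g(2) a by (intro hull_minimal convex_halfspace_ge) (force simp: x_def)
    then have "?F face_of C"
      by (intro face_of_Int_supporting_hyperplane_ge) (auto simp: CX)
    moreover have "x i \<in> ?F \<longleftrightarrow> i \<in> A" if "i < n" for i
    proof -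
      have "x i \<in> C" using that by (auto simp: CX intro: hull_inc)
      moreover have "a \<bullet> x i = - coeff g 0 \<longleftrightarrow> poly g (t i) = 0"
        using a[of "t i"] by (auto simp: x_def)
      ultimately show ?thesis using g(2)[OF that] by auto
    qed
    ultimately show ?thesis by blast
  qed
  have vert: "\<exists>S. S \<subseteq> {..<n} \<and> F = convex hull (x ` S)" if "F face_of C" for F
  proof -
    obtain S' where "S' \<subseteq> x ` {..<n}" "F = convex hull S'"
      using face_of_convex_hull_subset[OF comp] \<open>F face_of C\<close> CX by metis
    then show ?thesis by (metis subset_image_iff)
  qed
  have "{x i} face_of C" if i: "i < n" for i
  proof -
    have "gale_face n (0 + 2) (insert i {..<0})"
      by (rule gale_face_insert[OF gale_face_initial i])
    then have "gale_face n CARD('d) {i}" using gale_face_mono d by auto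
    then obtain F where F: "F face_of C" "\<And>j. j < n \<Longrightarrow> x j \<in> F \<longleftrightarrow> j \<in> {i}" using face by blast
    obtain S where S: "S \<subseteq> {..<n}" "F = convex hull (x ` S)" using vert[OF F(1)] by blast
    have "S \<subseteq> {i}"
    proof
      fix j assume "j \<in> S"
      then have "x j \<in> F" "j < n" using S by (auto intro: hull_inc)
      then show "j \<in> {i}" using F(2) by blast
    qed
    moreover have "S \<noteq> {}" using F(2)[of i] i S(2) by auto
    ultimately have "S = {i}" by blast
    then show ?thesis using F(1) S(2) by simp
  qed
  moreover have "\<exists>i<n. x i \<in> F" if F: "F face_of C" "F \<noteq> {}" for F
  proof -
    obtain S where S: "S \<subseteq> {..<n}" "F = convex hull (x ` S)" using vert[OF F(1)] by blast
    then obtain i where "i \<in> S" using F(2) by fastforce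
    then show ?thesis using S by (auto intro: hull_inc)
  qed
  ultimately show ?thesis using face that by blast
qed

subsection \<open>Extreme rays of pointed cones\<close>

text \<open>The cone is the intersection of the half-spaces that bound the hemispheres; the absence
  of antipodal points makes it pointed.\<close>

lemma spherical_polytope_cone:
  fixes P :: "'a::euclidean_space set"
  assumes P: "spherical_polytope P"
  shows "convex (polytope_cone P)" "conic (polytope_cone P)" "closed (polytope_cone P)"
    "0 \<in> polytope_cone P" "polytope_cone P \<inter> sphere 0 1 = P"
    "\<And>x. x \<in> polytope_cone P \<Longrightarrow> - x \<in> polytope_cone P \<Longrightarrow> x = 0"
proof -
  have "\<exists>\<H>. finite \<H> \<and> (\<forall>H\<in>\<H>. closed_hemisphere H) \<and> P = sphere 0 1 \<inter> \<Inter>\<H>"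
    using P unfolding spherical_polytope_def by (rule conjunct1)
  then obtain \<H> where H: "\<And>H. H \<in> \<H> \<Longrightarrow> closed_hemisphere H" "P = sphere 0 1 \<inter> \<Inter>\<H>"
    by (elim exE conjE) (metis (no_types))
  have anti: "- x \<notin> P" if "x \<in> P" for x
    using P that unfolding spherical_polytope_def by simp
  have "\<exists>a. \<forall>x. x \<in> H \<longleftrightarrow> x \<in> sphere 0 1 \<and> 0 \<le> a \<bullet> x" if "H \<in> \<H>" for H
    using H(1)[OF that] unfolding closed_hemisphere_def by blast
  then obtain a where a: "\<And>H x. H \<in> \<H> \<Longrightarrow> x \<in> H \<longleftrightarrow> x \<in> sphere 0 1 \<and> 0 \<le> a H \<bullet> x"
    by metis
  have PK: "P = {x \<in> sphere 0 1. \<forall>H\<in>\<H>. 0 \<le> a H \<bullet> x}"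
    unfolding H(2) by (auto simp: a)
  have K: "polytope_cone P = (\<Inter>H\<in>\<H>. {x. 0 \<le> a H \<bullet> x})"
  proof (intro set_eqI iffI)
    fix x assume "x \<in> polytope_cone P"
    then show "x \<in> (\<Inter>H\<in>\<H>. {x. 0 \<le> a H \<bullet> x})"
      by (auto simp: polytope_cone_def conic_hull_explicit PK)
  next
    fix x assume x: "x \<in> (\<Inter>H\<in>\<H>. {x. 0 \<le> a H \<bullet> x})"
    show "x \<in> polytope_cone P"
    proof (cases "x = 0")
      case False
      then have "(1 / norm x) *\<^sub>R x \<in> P" using x by (auto simp: PK)
      then have "\<exists>c y. x = c *\<^sub>R y \<and> 0 \<le> c \<and> y \<in> insert 0 P"
        using False by (intro exI[of _ "norm x"] exI[of _ "(1 / norm x) *\<^sub>R x"]) auto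
      then show ?thesis by (auto simp: polytope_cone_def conic_hull_explicit)
    qed (auto simp: polytope_cone_def hull_inc)
  qed
  show "convex (polytope_cone P)"
    unfolding K using convex_halfspace_ge[of 0] by (intro convex_INT) auto
  show "closed (polytope_cone P)"
    unfolding K using closed_halfspace_ge[of 0] by (intro closed_INT) auto
  show "conic (polytope_cone P)" by (simp add: polytope_cone_def conic_conic_hull)
  show "0 \<in> polytope_cone P" by (simp add: K)
  show PKS: "polytope_cone P \<inter> sphere 0 1 = P" unfolding K by (auto simp: PK)
  fix x assume x: "x \<in> polytope_cone P" "- x \<in> polytope_cone P"
  show "x = 0"
  proof (rule ccontr)
    assume "x \<noteq> 0"
    then have "(1 / norm x) *\<^sub>R x \<in> P" "- ((1 / norm x) *\<^sub>R x) \<in> P"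
      using x unfolding K by (auto simp: PK divide_le_0_iff)
    then show False using anti by blast
  qed
qed

text \<open>Pointedness makes \<open>K - {0}\<close> convex, so the convex hull of the compact set
  \<open>K \<inter> sphere 0 1\<close> misses the origin. Strict separation gives
  \<open>norm x * b < a \<bullet> x\<close>, which also bounds the slice.\<close>

lemma pointed_cone_functional:
  fixes K :: "'a::euclidean_space set"
  assumes K: "convex K" "conic K" "closed K" and pointed: "\<And>x. x \<in> K \<Longrightarrow> - x \<in> K \<Longrightarrow> x = 0"
  obtains a where "\<And>x. x \<in> K \<Longrightarrow> x \<noteq> 0 \<Longrightarrow> 0 < a \<bullet> x" "compact (K \<inter> {x. a \<bullet> x = 1})"
proof -
  have scale: "c *\<^sub>R x \<in> K" if "x \<in> K" "0 \<le> c" for x c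
    using conicD[OF K(2)] that by auto
  have conv: "convex (K - {0})"
  proof (rule convexI)
    fix x y :: 'a and u w :: real
    assume xy: "x \<in> K - {0}" "y \<in> K - {0}" and uw: "0 \<le> u" "0 \<le> w" "u + w = 1"
    have "u *\<^sub>R x + w *\<^sub>R y \<noteq> 0"
    proof
      assume 0: "u *\<^sub>R x + w *\<^sub>R y = 0"
      have "u *\<^sub>R x \<in> K" "w *\<^sub>R y \<in> K" using scale xy uw by auto
      moreover have "- (u *\<^sub>R x) = w *\<^sub>R y" "- (w *\<^sub>R y) = u *\<^sub>R x"
        using 0 by (auto simp: add_eq_0_iff add_eq_0_iff2)
      ultimately have "u *\<^sub>R x = 0" "w *\<^sub>R y = 0" using pointed by metis+
      then show False using xy uw by auto
    qed
    then show "u *\<^sub>R x + w *\<^sub>R y \<in> K - {0}"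
      using convexD[OF K(1), of x y u w] xy uw by auto
  qed
  let ?P = "K \<inter> sphere 0 1"
  have "compact ?P" using K(3) by (simp add: closed_Int_compact)
  then have "closed (convex hull ?P)" by (simp add: compact_convex_hull compact_imp_closed)
  moreover have "convex hull ?P \<subseteq> K - {0}" by (intro hull_minimal conv) auto
  ultimately obtain a b where ab: "0 < b" "\<And>x. x \<in> convex hull ?P \<Longrightarrow> b < a \<bullet> x"
    using separating_hyperplane_closed_0[of "convex hull ?P"] by blast
  have low: "norm x * b < a \<bullet> x" if "x \<in> K" "x \<noteq> 0" for x
  proof -
    have "(1 / norm x) *\<^sub>R x \<in> ?P" using that scale[of x "1 / norm x"] by simp
    then have "b < a \<bullet> ((1 / norm x) *\<^sub>R x)" using ab(2) hull_inc by metis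
    then show ?thesis using that(2) by (simp add: field_simps)
  qed
  have "0 < a \<bullet> x" if "x \<in> K" "x \<noteq> 0" for x
    using low[OF that] ab(1) by (smt (verit) mult_nonneg_nonneg norm_ge_zero)
  moreover have "compact (K \<inter> {x. a \<bullet> x = 1})"
  proof -
    have "norm x \<le> 1 / b" if "x \<in> K \<inter> {x. a \<bullet> x = 1}" for x
      using low[of x] that ab(1) by (cases "x = 0") (auto simp: field_simps)
    then have "bounded (K \<inter> {x. a \<bullet> x = 1})" unfolding bounded_iff by blast
    moreover have "closed (K \<inter> {x. a \<bullet> x = 1})"
      by (intro closed_Int K(3) closed_hyperplane)
    ultimately show ?thesis by (simp add: compact_eq_bounded_closed)
  qed
  ultimately show ?thesis using that by blast
qed

lemma extreme_ray_of_slice: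
  fixes K :: "'a::euclidean_space set"
  assumes K: "conic K" and a: "\<And>x. x \<in> K \<Longrightarrow> x \<noteq> 0 \<Longrightarrow> 0 < a \<bullet> x"
    and e: "e extreme_point_of (K \<inter> {x. a \<bullet> x = 1})"
  shows "{c *\<^sub>R e |c. 0 \<le> c} face_of K" (is "?R face_of K")
proof -
  have eK: "e \<in> K" "a \<bullet> e = 1" using e by (auto simp: extreme_point_of_def)
  have scale: "c *\<^sub>R x \<in> K" if "x \<in> K" "0 \<le> c" for x c
    using conicD[OF K] that by auto
  have conv: "convex ?R"
  proof (rule convexI)
    fix x y and u w :: real assume "x \<in> ?R" "y \<in> ?R" "0 \<le> u" "0 \<le> w"
    then obtain b c where "x = b *\<^sub>R e" "y = c *\<^sub>R e" "0 \<le> b" "0 \<le> c" by auto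
    then have "u *\<^sub>R x + w *\<^sub>R y = (u * b + w * c) *\<^sub>R e" "0 \<le> u * b + w * c"
      using \<open>0 \<le> u\<close> \<open>0 \<le> w\<close> by (auto simp: algebra_simps)
    then show "u *\<^sub>R x + w *\<^sub>R y \<in> ?R" by blast
  qed
  have ext: "x \<in> ?R \<and> y \<in> ?R" if x: "x \<in> K" and y: "y \<in> K" and z: "z \<in> ?R" "z \<in> open_segment x y" for x y z
  proof -
    obtain c where c: "z = c *\<^sub>R e" "0 \<le> c" using z(1) by blast
    obtain u where u: "0 < u" "u < 1" "z = (1 - u) *\<^sub>R x + u *\<^sub>R y"
      using z(2) by (auto simp: in_segment)
    consider "x = 0" | "y = 0" | "x \<noteq> 0" "y \<noteq> 0" by blast
    then show ?thesis
    proof cases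
      case 1
      then have "c *\<^sub>R e = u *\<^sub>R y" using u c by simp
      then have "(1 / u) *\<^sub>R (c *\<^sub>R e) = (1 / u) *\<^sub>R (u *\<^sub>R y)" by simp
      then have "y = (c / u) *\<^sub>R e" using u by simp
      moreover have "x = 0 *\<^sub>R e" "0 \<le> c / u" using 1 c u by simp_all
      ultimately show ?thesis by blast
    next
      case 2
      then have "c *\<^sub>R e = (1 - u) *\<^sub>R x" using u c by simp
      then have "(1 / (1 - u)) *\<^sub>R (c *\<^sub>R e) = (1 / (1 - u)) *\<^sub>R ((1 - u) *\<^sub>R x)" by simp
      then have "x = (c / (1 - u)) *\<^sub>R e" using u by simp
      moreover have "y = 0 *\<^sub>R e" "0 \<le> c / (1 - u)" using 2 c u by simp_all
      ultimately show ?thesis by blast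
    next
      case 3
      define r s where "r = a \<bullet> x" and "s = a \<bullet> y"
      have rs: "0 < r" "0 < s" using a x y 3 by (auto simp: r_def s_def)
      have "a \<bullet> z = c" using c eK by simp
      then have cc: "c = (1 - u) * r + u * s" using u by (simp add: r_def s_def inner_simps)
      have parts: "0 < (1 - u) * r" "0 < u * s" using rs u by simp_all
      then have "0 < c" using cc by simp
      define x' y' where "x' = (1 / r) *\<^sub>R x" and "y' = (1 / s) *\<^sub>R y"
      have xy': "x' \<in> K \<inter> {x. a \<bullet> x = 1}" "y' \<in> K \<inter> {x. a \<bullet> x = 1}"
        using scale x y rs by (auto simp: x'_def y'_def r_def s_def)
      \<comment> \<open>Rescaling the endpoints into the slice turns the weight \<open>u\<close>
        into \<open>w\<close>; extremality of \<open>e\<close> then makes the rescaled endpoints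
        equal.\<close>
      define w where "w = u * s / c"
      have w: "0 < w" "w < 1" "1 - w = (1 - u) * r / c"
        using parts \<open>0 < c\<close> cc by (simp_all add: w_def divide_less_eq eq_divide_eq left_diff_distrib)
      have "e = (1 / c) *\<^sub>R z" using c \<open>0 < c\<close> by simp
      also have "\<dots> = (1 - w) *\<^sub>R x' + w *\<^sub>R y'"
        unfolding w(3) using rs by (simp add: w_def x'_def y'_def u(3) scaleR_add_right)
      finally have ee: "e = (1 - w) *\<^sub>R x' + w *\<^sub>R y'" .
      have "x' = y'"
      proof (rule ccontr)
        assume "x' \<noteq> y'"
        then have "e \<in> open_segment x' y'" using ee w by (auto simp: in_segment)
        then show False using e xy' by (auto simp: extreme_point_of_def)
      qed
      then have "x' = e" "y' = e"
        using ee by (simp_all flip: scaleR_left_distrib)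
      moreover have "x = r *\<^sub>R x'" "y = s *\<^sub>R y'" using rs by (simp_all add: x'_def y'_def)
      ultimately have "x = r *\<^sub>R e" "y = s *\<^sub>R e" by (simp_all only:)
      moreover have "0 \<le> r" "0 \<le> s" using rs by simp_all
      ultimately show ?thesis by blast
    qed
  qed
  show ?thesis
    unfolding face_of_def
  proof (intro conjI ballI impI conv)
    show "?R \<subseteq> K" using scale eK(1) by blast
    fix x y z assume "x \<in> K" "y \<in> K" "z \<in> ?R" "z \<in> open_segment x y"
    from ext[OF this] show "x \<in> ?R" "y \<in> ?R" by simp_all
  qed
qed

text \<open>Krein-Milman for a compact slice of \<open>G\<close>, whose extreme points span extreme
  rays of \<open>K\<close>. \<open>W\<close> is kept general: a finitely generated cone shows that
  the rays generate \<open>G\<close>, and \<open>{0}\<close> yields the existence of a ray in a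
  nontrivial face.\<close>

lemma face_generated_by_extreme_rays:
  fixes K :: "'a::euclidean_space set"
  assumes K: "convex K" "conic K" "closed K" and pointed: "\<And>x. x \<in> K \<Longrightarrow> - x \<in> K \<Longrightarrow> x = 0"
    and G: "G face_of K" and W: "convex W" "conic W" "0 \<in> W"
    and rays: "\<And>e. e \<in> G \<Longrightarrow> norm e = 1 \<Longrightarrow> {c *\<^sub>R e |c. 0 \<le> c} face_of K \<Longrightarrow> e \<in> W"
  shows "G \<subseteq> W"
proof
  fix x assume x: "x \<in> G"
  obtain a where a: "\<And>x. x \<in> K \<Longrightarrow> x \<noteq> 0 \<Longrightarrow> 0 < a \<bullet> x" "compact (K \<inter> {x. a \<bullet> x = 1})"
    using pointed_cone_functional[OF K pointed] by blast
  have GK: "G \<subseteq> K" using G by (rule face_of_imp_subset)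
  have conicG: "conic G" using face_of_conic[OF K(2) G] .
  let ?H = "G \<inter> {x. a \<bullet> x = 1}" and ?Q = "K \<inter> {x. a \<bullet> x = 1}"
  have HQ: "?H face_of ?Q" using G by (intro face_of_slice) (simp_all add: convex_hyperplane)
  have convQ: "convex ?Q" by (intro convex_Int K(1) convex_hyperplane)
  have "compact ?H" "convex ?H"
    using face_of_imp_compact[OF convQ a(2) HQ] face_of_imp_convex[OF HQ] by auto
  then have H: "?H = convex hull {e. e extreme_point_of ?H}" by (rule Krein_Milman_Minkowski)
  have "e \<in> W" if "e extreme_point_of ?H" for e
  proof -
    have e: "e extreme_point_of ?Q" "e \<in> G" "a \<bullet> e = 1"
      using that extreme_point_of_face[OF HQ] by auto
    then have "e \<noteq> 0" by auto
    define e' where "e' = (1 / norm e) *\<^sub>R e"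
    have ee': "e = norm e *\<^sub>R e'" using \<open>e \<noteq> 0\<close> by (simp add: e'_def)
    have "{c *\<^sub>R e' |c. 0 \<le> c} = {c *\<^sub>R e |c. 0 \<le> c}"
    proof (intro equalityI subsetI)
      fix y assume "y \<in> {c *\<^sub>R e' |c. 0 \<le> c}"
      then obtain c where "y = (c / norm e) *\<^sub>R e" "0 \<le> c" by (auto simp: e'_def)
      then show "y \<in> {c *\<^sub>R e |c. 0 \<le> c}" by (intro CollectI exI[of _ "c / norm e"]) auto
    next
      fix y assume "y \<in> {c *\<^sub>R e |c. 0 \<le> c}"
      then obtain c where c: "y = c *\<^sub>R e" "0 \<le> c" by blast
      have "y = (c * norm e) *\<^sub>R e'" unfolding c(1) by (subst ee') simp
      then show "y \<in> {c *\<^sub>R e' |c. 0 \<le> c}" using c(2) by (intro CollectI exI[of _ "c * norm e"]) auto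
    qed
    then have "{c *\<^sub>R e' |c. 0 \<le> c} face_of K"
      using extreme_ray_of_slice[OF K(2) a(1) e(1)] by simp
    moreover have "e' \<in> G" "norm e' = 1"
      using conicD[OF conicG e(2), of "1 / norm e"] \<open>e \<noteq> 0\<close> by (auto simp: e'_def)
    ultimately have "e' \<in> W" using rays by blast
    then show ?thesis using conicD[OF W(2), of e' "norm e"] ee' by simp
  qed
  then have HW: "?H \<subseteq> W" by (subst H, intro hull_minimal W(1)) auto
  show "x \<in> W"
  proof (cases "x = 0")
    case False
    then have pos: "0 < a \<bullet> x" using a(1) x GK by blast
    then have "(1 / (a \<bullet> x)) *\<^sub>R x \<in> ?H"
      using conicD[OF conicG x, of "1 / (a \<bullet> x)"] by simp
    then have "(1 / (a \<bullet> x)) *\<^sub>R x \<in> W" using HW by blast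
    from conicD[OF W(2) this, of "a \<bullet> x"] show ?thesis using pos by simp
  qed (use W in simp)
qed

subsection \<open>Tangency in terms of the Lorentz form\<close>

lemma lorentz_self: "lorentz x x = - (fst x)\<^sup>2 + (\<Sum>i\<in>UNIV. (snd x $ i)\<^sup>2)" for x :: "real \<times> (real, 'd::finite) vec"
  by (simp add: lorentz_def inner_vec_def power2_eq_square)

lemma cap_boundary_subset_cap: "cap_boundary \<subseteq> (cap :: (real \<times> (real, 'd::finite) vec) set)"
proof -
  let ?S = "sphere 0 1 :: (real \<times> (real, 'd) vec) set"
  have closed: "closed {x :: real \<times> (real, 'd) vec. 0 \<le> fst x \<and> - (fst x)\<^sup>2 + (\<Sum>i\<in>UNIV. (snd x $ i)\<^sup>2) \<le> 0}"
    by (intro closed_Collect_conj closed_Collect_le continuous_intros)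
  have "cap = ?S \<inter> {x. 0 \<le> fst x \<and> - (fst x)\<^sup>2 + (\<Sum>i\<in>UNIV. (snd x $ i)\<^sup>2) \<le> 0}"
    by (auto simp: cap_def)
  then have "closedin (top_of_set ?S) cap"
    using closedin_closed_Int[OF closed, of ?S] by (simp only:)
  then show ?thesis
    unfolding cap_boundary_def by (rule frontier_of_subset_closedin)
qed

lemma cap_interiorI:
  fixes x :: "real \<times> (real, 'd::finite) vec"
  assumes "norm x = 1" "0 < fst x" "lorentz x x < 0"
  shows "x \<in> cap_interior"
proof -
  let ?U = "{x :: real \<times> (real, 'd) vec. 0 < fst x \<and> lorentz x x < 0}"
  have "open ?U"
    unfolding lorentz_def by (intro open_Collect_conj open_Collect_less continuous_intros)
  then have "openin (top_of_set (sphere 0 1)) (sphere 0 1 \<inter> ?U)" by (rule openin_open_Int)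
  moreover have "sphere 0 1 \<inter> ?U \<subseteq> cap"
    by (auto simp: cap_def lorentz_self)
  ultimately have "sphere 0 1 \<inter> ?U \<subseteq> cap_interior"
    unfolding cap_interior_def by (intro interior_of_maximal)
  moreover have "x \<in> sphere 0 1 \<inter> ?U" using assms by simp
  ultimately show ?thesis by blast
qed

text \<open>From a relatively interior point one can move a little in direction \<open>- y\<close>,
  renormalize and stay in the face; by independence the coefficient of \<open>y\<close> at
  \<open>p\<close> is at least the step \<open>s\<close>.\<close>

lemma relint_simplicial_cone_positive:
  fixes X :: "'a::euclidean_space set"
  assumes X: "finite X" "independent X"
    and F: "F = {\<Sum>x\<in>X. c x *\<^sub>R x |c. \<forall>x\<in>X. 0 \<le> c x} \<inter> sphere 0 1" "span F = span X"
    and p: "p \<in> spherical_relint F"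
  shows "\<exists>c. (\<forall>x\<in>X. 0 < c x) \<and> p = (\<Sum>x\<in>X. c x *\<^sub>R x)"
proof -
  have "\<exists>T. openin (top_of_set (spherical_span F)) T \<and> p \<in> T \<and> T \<subseteq> F"
    using p by (simp add: spherical_relint_def interior_of_def)
  then obtain T where T: "openin (top_of_set (spherical_span F)) T" "p \<in> T" "T \<subseteq> F"
    by blast
  then obtain U where U: "open U" "T = spherical_span F \<inter> U" by (auto simp: openin_open)
  have "p \<in> F" using T by blast
  then obtain c where c: "p = (\<Sum>x\<in>X. c x *\<^sub>R x)" "\<And>x. x \<in> X \<Longrightarrow> 0 \<le> c x" and np: "norm p = 1"
    unfolding F(1) by auto
  have "0 < c y" if y: "y \<in> X" for y
  proof -
    define g where "g = (\<lambda>s. p - s *\<^sub>R y)"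
    have gl: "(g \<longlongrightarrow> p) (at_right 0)"
      unfolding g_def by (rule tendsto_eq_intros refl | simp)+
    have "((\<lambda>s. (1 / norm (g s)) *\<^sub>R g s) \<longlongrightarrow> (1 / norm p) *\<^sub>R p) (at_right 0)"
      using np by (intro tendsto_intros gl) auto
    then have lim: "((\<lambda>s. (1 / norm (g s)) *\<^sub>R g s) \<longlongrightarrow> p) (at_right 0)" using np by simp
    have "p \<in> U" using T U by blast
    then have "\<forall>\<^sub>F s in at_right 0. (1 / norm (g s)) *\<^sub>R g s \<in> U"
      using topological_tendstoD[OF lim U(1)] by blast
    moreover have "\<forall>\<^sub>F s in at_right 0. g s \<noteq> 0"
      using np by (intro tendsto_imp_eventually_ne[OF gl]) auto
    moreover have "\<forall>\<^sub>F s::real in at_right 0. 0 < s" by (rule eventually_at_right_less)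
    ultimately have "\<forall>\<^sub>F s in at_right 0. (1 / norm (g s)) *\<^sub>R g s \<in> U \<and> g s \<noteq> 0 \<and> 0 < s"
      by (intro eventually_conj)
    from eventually_happens'[OF _ this]
    obtain s where s: "(1 / norm (g s)) *\<^sub>R g s \<in> U" "g s \<noteq> 0" "0 < s"
      by (auto simp: trivial_limit_at_right_real)
    have "p \<in> span X" unfolding c(1) by (intro span_sum span_scale span_base)
    then have "(1 / norm (g s)) *\<^sub>R g s \<in> span F"
      unfolding F(2) g_def using y by (intro span_scale span_diff) (auto intro: span_base)
    then have "(1 / norm (g s)) *\<^sub>R g s \<in> T"
      using s U(2) by (simp add: spherical_span_def)
    then obtain b where b: "(1 / norm (g s)) *\<^sub>R g s = (\<Sum>x\<in>X. b x *\<^sub>R x)" "\<And>x. x \<in> X \<Longrightarrow> 0 \<le> b x"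
      using T(3) unfolding F(1) by blast
    define N where "N = norm (g s)"
    have "g s = N *\<^sub>R ((1 / norm (g s)) *\<^sub>R g s)" using s by (simp add: N_def)
    also have "\<dots> = (\<Sum>x\<in>X. (N * b x) *\<^sub>R x)" unfolding b(1) by (simp add: scaleR_sum_right)
    finally have gs: "g s = (\<Sum>x\<in>X. (N * b x) *\<^sub>R x)" .
    have "(\<Sum>x\<in>X. (c x - N * b x - (if x = y then s else 0)) *\<^sub>R x) = p - g s - s *\<^sub>R y"
      unfolding gs c(1) using X(1) y
      by (simp add: scaleR_diff_left sum_subtractf if_distrib[of "\<lambda>z. z *\<^sub>R _"] cong: if_cong)
    also have "\<dots> = 0" by (simp add: g_def)
    finally have "c y - N * b y - (if y = y then s else 0) = 0"
      by (rule independentD[OF X(2) X(1) subset_refl _ y])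
    moreover have "0 \<le> N * b y" using b(2)[OF y] by (simp add: N_def)
    ultimately show ?thesis using s(3) by simp
  qed
  then show ?thesis using c(1) by blast
qed

lemma tangent_face_vectors:
  fixes X :: "(real \<times> (real, 'd::finite) vec) set"
  assumes X: "finite X" "independent X"
    and F: "F = {\<Sum>x\<in>X. c x *\<^sub>R x |c. \<forall>x\<in>X. 0 \<le> c x} \<inter> sphere 0 1" "span F = span X"
    and tangent: "tangent_face F"
  shows "tangent_vectors X"
proof -
  obtain p where "spherical_relint F \<inter> cap_boundary = {p}" and avoid: "spherical_span F \<inter> cap_interior = {}"
    using tangent by (auto simp: tangent_face_def)
  then have p: "p \<in> spherical_relint F" "p \<in> cap_boundary" by auto
  obtain c where c: "\<And>x. x \<in> X \<Longrightarrow> 0 < c x" "p = (\<Sum>x\<in>X. c x *\<^sub>R x)"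
    using relint_simplicial_cone_positive[OF X F p(1)] by blast
  have nonneg: "0 \<le> lorentz x x" if x: "x \<in> span X" for x
  proof (rule ccontr)
    assume neg: "\<not> 0 \<le> lorentz x x"
    then have "fst x \<noteq> 0" by (auto simp: lorentz_def)
    \<comment> \<open>The cap contains only the half of the light cone with nonnegative first
      coordinate; the sign selects the representative in that half.\<close>
    define r where "r = sgn (fst x) / norm x"
    have "x \<noteq> 0" using neg by auto
    then have "norm (r *\<^sub>R x) = 1" "0 < fst (r *\<^sub>R x)" "lorentz (r *\<^sub>R x) (r *\<^sub>R x) < 0"
      using neg \<open>fst x \<noteq> 0\<close>
      by (auto simp: r_def lorentz_linear abs_sgn_eq sgn_if mult_less_0_iff zero_less_mult_iff divide_less_0_iff)
    then have "r *\<^sub>R x \<in> cap_interior" "r *\<^sub>R x \<in> spherical_span F"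
      using x by (auto simp: spherical_span_def F(2) span_scale intro: cap_interiorI)
    then show False using avoid by blast
  qed
  \<comment> \<open>The cap inequality gives \<open>lorentz p p \<le> 0\<close>, and
    semidefiniteness on the span the reverse.\<close>
  have "p \<in> cap" using p(2) cap_boundary_subset_cap by blast
  then have np: "norm p = 1" "lorentz p p \<le> 0" by (auto simp: cap_def lorentz_self)
  moreover have "p \<in> span X" unfolding c(2) by (intro span_sum span_scale span_base)
  ultimately have "lorentz p p = 0" "p \<noteq> 0" using nonneg[of p] by auto
  then show ?thesis using c nonneg unfolding tangent_vectors_def by blast
qed

section \<open>From a realization to vertex vectors\<close>

lemma convex_conic_sums:
  fixes v :: "'b \<Rightarrow> 'a::real_vector" and A :: "'b set"
  defines "W \<equiv> {\<Sum>i\<in>A. c i *\<^sub>R v i |c. \<forall>i\<in>A. (0::real) \<le> c i}" 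
  shows "convex W" "conic W" "0 \<in> W"
proof -
  show "0 \<in> W" unfolding W_def by (intro CollectI exI[of _ "\<lambda>_. 0"]) simp
  show "conic W"
    unfolding conic_def W_def
  proof clarify
    fix r :: real and c :: "'b \<Rightarrow> real" assume "0 \<le> r" "\<forall>i\<in>A. 0 \<le> c i"
    then show "\<exists>b. r *\<^sub>R (\<Sum>i\<in>A. c i *\<^sub>R v i) = (\<Sum>i\<in>A. b i *\<^sub>R v i) \<and> (\<forall>i\<in>A. 0 \<le> b i)"
      by (intro exI[of _ "\<lambda>i. r * c i"]) (simp add: scaleR_sum_right)
  qed
  show "convex W"
  proof (rule convexI)
    fix x y and r s :: real assume "x \<in> W" "y \<in> W" and rs: "0 \<le> r" "0 \<le> s" "r + s = 1"
    then obtain b c where b: "x = (\<Sum>i\<in>A. b i *\<^sub>R v i)" "\<forall>i\<in>A. 0 \<le> b i"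
      and c: "y = (\<Sum>i\<in>A. c i *\<^sub>R v i)" "\<forall>i\<in>A. 0 \<le> c i"
      unfolding W_def by blast
    show "r *\<^sub>R x + s *\<^sub>R y \<in> W"
      unfolding W_def b(1) c(1) using rs b(2) c(2)
      by (intro CollectI exI[of _ "\<lambda>i. r * b i + s * c i"])
        (simp add: scaleR_sum_right scaleR_add_left sum.distrib)
  qed
qed

text \<open>The lattice isomorphism matches vertices with extreme rays, and \<open>v i\<close> is
  the unit vector on the ray of the \<open>i\<close>-th vertex. A Gale face goes to a face of the
  cone whose extreme rays are exactly those of its vertices, so it is the cone they
  generate.\<close>

lemma realization_faces:
  fixes C :: "(real ^ 'd::{finite,linorder}) set" and P :: "(real \<times> (real ^ 'd::{finite,linorder})) set"
  assumes C: "cyclic_polytope n C" and d: "2 \<le> CARD('d)" and P: "realizes P C"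
  obtains v where "\<And>i. i < n \<Longrightarrow> norm (v i) = 1"
    "\<And>A. gale_face n CARD('d) A \<Longrightarrow> A \<subseteq> {..<n} \<Longrightarrow>
      {\<Sum>i\<in>A. c i *\<^sub>R v i |c. \<forall>i\<in>A. 0 \<le> c i} face_of polytope_cone P"
    "\<And>A j. gale_face n CARD('d) A \<Longrightarrow> A \<subseteq> {..<n} \<Longrightarrow> j < n \<Longrightarrow>
      v j \<in> {\<Sum>i\<in>A. c i *\<^sub>R v i |c. \<forall>i\<in>A. 0 \<le> c i} \<Longrightarrow> j \<in> A"
    "\<And>i. i < n \<Longrightarrow> v i \<in> polytope_cone P"
proof -
  define K where "K = polytope_cone P"
  have sph: "spherical_polytope P"
    using P by (simp add: realizes_def spherical_d_polytope_def)
  note KK = spherical_polytope_cone[OF sph, folded K_def]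
  obtain f where bij: "bij_betw f {F. F face_of C} (spherical_faces P)"
    and mono: "\<And>X Y. X face_of C \<Longrightarrow> Y face_of C \<Longrightarrow> X \<subseteq> Y \<longleftrightarrow> f X \<subseteq> f Y"
    using P unfolding realizes_def order_isomorphic_def by (elim conjE exE) blast
  obtain x where x: "\<And>i. i < n \<Longrightarrow> {x i} face_of C"
    "\<And>A. gale_face n CARD('d) A \<Longrightarrow> \<exists>F. F face_of C \<and> (\<forall>i<n. x i \<in> F \<longleftrightarrow> i \<in> A)"
    "\<And>F. F face_of C \<Longrightarrow> F \<noteq> {} \<Longrightarrow> \<exists>i<n. x i \<in> F"
    using cyclic_polytope_faces[OF C d] by blast
  \<comment> \<open>The cone faces \<open>{}\<close> and \<open>{0}\<close> give the same spherical
    face, so a representative containing the origin can be chosen.\<close>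
  have fG: "\<exists>G. G face_of K \<and> 0 \<in> G \<and> f F = G \<inter> sphere 0 1" if F: "F face_of C" for F
  proof -
    have "f F \<in> spherical_faces P" using bij F unfolding bij_betw_def by blast
    then obtain G where G: "G face_of K" "f F = G \<inter> sphere 0 1"
      unfolding spherical_faces_def K_def by blast
    show ?thesis
    proof (cases "G = {}")
      case True
      have "{0} face_of K"
        unfolding face_of_singleton extreme_point_of_def
      proof (intro conjI ballI notI KK(4))
        fix y z assume yz: "y \<in> K" "z \<in> K" and "0 \<in> open_segment y z"
        then obtain u where u: "0 < u" "u < 1" "0 = (1 - u) *\<^sub>R y + u *\<^sub>R z" "y \<noteq> z"
          by (auto simp: in_segment)
        have "(1 - u) *\<^sub>R y \<in> K" "u *\<^sub>R z \<in> K" using conicD[OF KK(2)] yz u by simp_all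
        moreover have "- ((1 - u) *\<^sub>R y) = u *\<^sub>R z" "- (u *\<^sub>R z) = (1 - u) *\<^sub>R y"
          using u(3) by (metis add.commute minus_unique)+
        ultimately have "(1 - u) *\<^sub>R y = 0" "u *\<^sub>R z = 0" using KK(6) by metis+
        then show False using u by simp
      qed
      moreover have "f F = {0} \<inter> sphere 0 1" using G True by simp
      ultimately show ?thesis by blast
    next
      case False
      then obtain g where "g \<in> G" by blast
      then have "0 \<in> G" using conicD[OF face_of_conic[OF KK(2) G(1)], of g 0] by simp
      then show ?thesis using G by blast
    qed
  qed
  have sur: "\<exists>F. F face_of C \<and> f F = G \<inter> sphere 0 1" if "G face_of K" for G
  proof -
    have "G \<inter> sphere 0 1 \<in> spherical_faces P" using that unfolding spherical_faces_def K_def by blast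
    then show ?thesis using bij unfolding bij_betw_def by (metis (mono_tags, lifting) imageE mem_Collect_eq)
  qed
  have f_empty: "f F = {} \<longleftrightarrow> F = {}" if F: "F face_of C" for F
  proof -
    obtain F0 where F0: "F0 face_of C" "f F0 = {} \<inter> sphere 0 1"
      using sur[OF empty_face_of] by blast
    have "f {} \<subseteq> f F0" using mono[of "{}" F0] F0(1) by simp
    then have "f {} = {}" using F0(2) by blast
    moreover have "f F = {} \<Longrightarrow> F \<subseteq> {}" using mono[OF F empty_face_of] by simp
    ultimately show ?thesis by blast
  qed
  define ray where "ray = (\<lambda>e :: real \<times> (real, 'd) vec. {c *\<^sub>R e |c. 0 \<le> c})"
  have ray_sphere: "ray e \<inter> sphere 0 1 = {e}" if "norm e = 1" for e
  proof -
    have "c *\<^sub>R e = e" if "0 \<le> c" "norm (c *\<^sub>R e) = 1" for c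
      using that \<open>norm e = 1\<close> by simp
    moreover have "e \<in> ray e" unfolding ray_def by (intro CollectI exI[of _ 1]) simp
    ultimately show ?thesis using that by (auto simp: ray_def)
  qed
  \<comment> \<open>The image of a vertex is nonempty and contains an extreme ray; the preimage of
    that ray is a nonempty face inside \<open>{x i}\<close>.\<close>
  have vertex: "\<exists>e. f {x i} = {e} \<and> norm e = 1" if i: "i < n" for i
  proof -
    obtain G where G: "G face_of K" "f {x i} = G \<inter> sphere 0 1" using fG[OF x(1)[OF i]] by blast
    have "G \<inter> sphere 0 1 \<noteq> {}" using f_empty[OF x(1)[OF i]] G(2) by simp
    then have "\<not> G \<subseteq> {0}" by auto
    then obtain e where e: "e \<in> G" "norm e = 1" "ray e face_of K"
      using face_generated_by_extreme_rays[OF KK(1-3) KK(6) G(1), of "{0}"] unfolding ray_def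
      by (auto simp: conic_def)
    obtain F where F: "F face_of C" "f F = {e}"
      using sur[OF e(3)] ray_sphere[OF e(2)] by auto
    have "f F \<subseteq> f {x i}" using F(2) G(2) e by auto
    then have "F \<subseteq> {x i}" using mono[OF F(1) x(1)[OF i]] by simp
    moreover have "F \<noteq> {}" using f_empty[OF F(1)] F(2) by auto
    ultimately have "F = {x i}" by blast
    then show ?thesis using F(2) e(2) by blast
  qed
  then obtain v where v: "\<And>i. i < n \<Longrightarrow> f {x i} = {v i}" "\<And>i. i < n \<Longrightarrow> norm (v i) = 1"
    by metis
  \<comment> \<open>Conversely, the face of \<open>C\<close> corresponding to an extreme ray
    contains some vertex, whose image must be that ray.\<close>
  have rays: "\<exists>i<n. e = v i" if e: "norm e = 1" "ray e face_of K" for e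
  proof -
    obtain F where F: "F face_of C" "f F = {e}"
      using sur[OF e(2)] ray_sphere[OF e(1)] by auto
    then have "F \<noteq> {}" using f_empty[OF F(1)] by auto
    then obtain i where i: "i < n" "x i \<in> F" using x(3)[OF F(1)] by blast
    then have "f {x i} \<subseteq> f F" using mono[OF x(1)[OF i(1)] F(1)] by simp
    then show ?thesis using v(1)[OF i(1)] F(2) i(1) by auto
  qed
  have vK: "v i \<in> K" if i: "i < n" for i
  proof -
    obtain G where G: "G face_of K" "f {x i} = G \<inter> sphere 0 1" using fG[OF x(1)[OF i]] by blast
    then have "v i \<in> G" using v(1)[OF i] by auto
    then show ?thesis using face_of_imp_subset[OF G(1)] by blast
  qed
  have cone: "{\<Sum>i\<in>A. c i *\<^sub>R v i |c. \<forall>i\<in>A. 0 \<le> c i} face_of K \<and>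
      (\<forall>j<n. v j \<in> {\<Sum>i\<in>A. c i *\<^sub>R v i |c. \<forall>i\<in>A. 0 \<le> c i} \<longrightarrow> j \<in> A)"
    if A: "gale_face n CARD('d) A" "A \<subseteq> {..<n}" for A
  proof -
    let ?W = "{\<Sum>i\<in>A. c i *\<^sub>R v i |c. \<forall>i\<in>A. 0 \<le> c i}"
    have "finite A" using A(2) finite_subset by blast
    obtain F where F: "F face_of C" "\<And>i. i < n \<Longrightarrow> x i \<in> F \<longleftrightarrow> i \<in> A" using x(2)[OF A(1)] by blast
    obtain G where G: "G face_of K" "0 \<in> G" "f F = G \<inter> sphere 0 1" using fG[OF F(1)] by blast
    have vG: "v i \<in> G \<longleftrightarrow> i \<in> A" if i: "i < n" for i
    proof -
      have "v i \<in> G \<longleftrightarrow> f {x i} \<subseteq> f F" using v[OF i] G(3) by simp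
      also have "\<dots> \<longleftrightarrow> {x i} \<subseteq> F" using mono[OF x(1)[OF i] F(1)] by simp
      finally show ?thesis using F(2)[OF i] by simp
    qed
    have "e \<in> ?W" if e: "e \<in> G" "norm e = 1" "{c *\<^sub>R e |c. 0 \<le> c} face_of K" for e
    proof -
      obtain i where i: "i < n" "e = v i" using rays[OF e(2)] e(3) unfolding ray_def by blast
      then have "i \<in> A" using vG e(1) by blast
      then show ?thesis
        unfolding i(2) using \<open>finite A\<close>
        by (intro CollectI exI[of _ "\<lambda>j. if j = i then 1 else 0"])
          (simp add: if_distrib[of "\<lambda>z. z *\<^sub>R _"] cong: if_cong)
    qed
    then have "G \<subseteq> ?W"
      by (intro face_generated_by_extreme_rays[OF KK(1-3) KK(6) G(1)] convex_conic_sums)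
    moreover have "?W \<subseteq> G"
    proof
      fix w assume "w \<in> ?W"
      then obtain c where w: "w = (\<Sum>i\<in>A. c i *\<^sub>R v i)" and c: "\<forall>i\<in>A. 0 \<le> c i" by blast
      have conv: "convex G" using face_of_imp_convex[OF G(1)] .
      have conicG: "conic G" by (rule face_of_conic[OF KK(2) G(1)])
      have add: "y + z \<in> G" if "y \<in> G" "z \<in> G" for y z
        using conicD[OF conicG convexD[OF conv that, of "1/2" "1/2"], of 2] by (simp add: scaleR_add_right)
      have scaled: "c i *\<^sub>R v i \<in> G" if "i \<in> A" for i
        using conicD[OF conicG, of "v i" "c i"] vG[of i] that c A(2) by blast
      have "(\<Sum>i\<in>B. c i *\<^sub>R v i) \<in> G" if "finite B" "B \<subseteq> A" for B
        using that by (induction B rule: finite_induct) (simp_all add: G(2) add scaled)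
      then show "w \<in> G" unfolding w using \<open>finite A\<close> by simp
    qed
    ultimately have "G = ?W" by blast
    then show ?thesis using G(1) vG by blast
  qed
  show ?thesis
  proof (rule that[of v])
    show "{\<Sum>i\<in>A. c i *\<^sub>R v i |c. \<forall>i\<in>A. 0 \<le> c i} face_of polytope_cone P"
      if "gale_face n CARD('d) A" "A \<subseteq> {..<n}" for A
      using cone[OF that] unfolding K_def by (rule conjunct1)
    show "j \<in> A" if "gale_face n CARD('d) A" "A \<subseteq> {..<n}" "j < n"
      "v j \<in> {\<Sum>i\<in>A. c i *\<^sub>R v i |c. \<forall>i\<in>A. 0 \<le> c i}" for A j
      using conjunct2[OF cone[OF that(1,2)]] that(3,4) by blast
  qed (use v(2) vK in \<open>simp_all add: K_def\<close>)
qed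

lemma scribed_cyclic_vertices_exist:
  fixes C :: "(real ^ 'd::{finite,linorder}) set"
  assumes C: "cyclic_polytope n C" and d: "2 \<le> CARD('d)" and k: "k_scribable k C"
  shows "\<exists>v :: nat \<Rightarrow> real \<times> (real, 'd) vec. scribed_cyclic_vertices n k v"
proof -
  obtain P where P: "realizes P C" "k_scribed k P" using k unfolding k_scribable_def by blast
  define cone where "cone = (\<lambda>(v :: nat \<Rightarrow> real \<times> (real, 'd) vec) A. {\<Sum>i\<in>A. c i *\<^sub>R v i |c. \<forall>i\<in>A. (0::real) \<le> c i})"
  obtain v where v: "\<And>i. i < n \<Longrightarrow> norm (v i) = 1"
    "\<And>A. gale_face n CARD('d) A \<Longrightarrow> A \<subseteq> {..<n} \<Longrightarrow> cone v A face_of polytope_cone P"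
    "\<And>A j. gale_face n CARD('d) A \<Longrightarrow> A \<subseteq> {..<n} \<Longrightarrow> j < n \<Longrightarrow> v j \<in> cone v A \<Longrightarrow> j \<in> A"
    "\<And>i. i < n \<Longrightarrow> v i \<in> polytope_cone P"
    using realization_faces[OF C d P(1)] unfolding cone_def by blast
  have sph: "spherical_polytope P"
    using P by (simp add: realizes_def spherical_d_polytope_def)
  note KK = spherical_polytope_cone[OF sph]
  have gen: "v i \<in> cone v A" if "i \<in> A" "finite A" for i A
    unfolding cone_def using that
    by (intro CollectI exI[of _ "\<lambda>j. if j = i then 1 else 0"])
      (simp add: if_distrib[of "\<lambda>z. z *\<^sub>R _"] cong: if_cong)
  have zero: "0 \<in> cone v A" for A unfolding cone_def by (rule convex_conic_sums)
  have in_span: "cone v A \<subseteq> span (v ` A)" for A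
  proof
    fix y assume "y \<in> cone v A"
    then obtain c where "y = (\<Sum>i\<in>A. c i *\<^sub>R v i)" unfolding cone_def by blast
    moreover have "(\<Sum>i\<in>A. c i *\<^sub>R v i) \<in> span (v ` A)"
      by (intro span_sum span_scale span_base imageI)
    ultimately show "y \<in> span (v ` A)" by simp
  qed
  have span_cone: "span (cone v A) = span (v ` A)" if "finite A" for A
    using in_span[of A] gen[OF _ that] by (intro span_eq[THEN iffD2]) (auto intro: span_base)
  have "v j \<notin> span (v ` A)" if A: "gale_face n CARD('d) A" "A \<subseteq> {..<n}" and j: "j < n" "j \<notin> A" for A j
  proof
    have fin: "finite A" using A(2) finite_subset by blast
    assume "v j \<in> span (v ` A)"
    \<comment> \<open>The cone contains the origin, so its affine hull is its span, and a face is
      the intersection of its affine hull with the whole cone.\<close>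
    then have "v j \<in> affine hull (cone v A)"
      using affine_hull_span_0[of "cone v A"] zero hull_inc span_cone[OF fin] by metis
    then have "v j \<in> cone v A"
      using face_of_imp_eq_affine_Int[OF KK(1) v(2)[OF A]] v(4)[OF j(1)] by blast
    then show False using v(3)[OF A j(1)] j(2) by blast
  qed
  moreover have "tangent_vectors (v ` A)"
    if A: "gale_face n CARD('d) A" "A \<subseteq> {..<n}" "card A = k + 1" "inj_on v A" "independent (v ` A)" for A
  proof -
    have fin: "finite A" using A(2) finite_subset by blast
    define F where "F = cone v A \<inter> sphere 0 1"
    \<comment> \<open>A simplicial cone on \<open>k + 1\<close> independent vectors has dimension
      \<open>k + 1\<close> and so gives a spherical \<open>k\<close>-face.\<close>
    have "aff_dim (cone v A) = int (dim (cone v A))"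
      using zero by (intro aff_dim_zero hull_inc)
    also have "dim (cone v A) = dim (v ` A)" using span_cone[OF fin] by (metis dim_span)
    also have "\<dots> = k + 1" using A(3-5) by (simp add: dim_eq_card_independent card_image)
    finally have "spherical_face_of k F P"
      unfolding spherical_face_of_def F_def using v(2)[OF A(1,2)] by auto
    then have "tangent_face F" using P(2) unfolding k_scribed_def by blast
    moreover have "cone v A = {\<Sum>x\<in>v ` A. c x *\<^sub>R x |c. \<forall>x\<in>v ` A. 0 \<le> c x}"
    proof (intro equalityI subsetI)
      fix y assume "y \<in> cone v A"
      then obtain c where c: "y = (\<Sum>i\<in>A. c i *\<^sub>R v i)" "\<forall>i\<in>A. 0 \<le> c i" unfolding cone_def by blast
      have "y = (\<Sum>x\<in>v ` A. c (the_inv_into A v x) *\<^sub>R x)"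
        unfolding c(1) using A(4) by (simp add: sum.reindex the_inv_into_f_f cong: sum.cong)
      then show "y \<in> {\<Sum>x\<in>v ` A. c x *\<^sub>R x |c. \<forall>x\<in>v ` A. 0 \<le> c x}"
        using c(2) A(4) by (intro CollectI exI[of _ "\<lambda>x. c (the_inv_into A v x)"]) (auto simp: the_inv_into_f_f)
    next
      fix y assume "y \<in> {\<Sum>x\<in>v ` A. c x *\<^sub>R x |c. \<forall>x\<in>v ` A. 0 \<le> c x}"
      then obtain c where "y = (\<Sum>x\<in>v ` A. c x *\<^sub>R x)" "\<forall>x\<in>v ` A. 0 \<le> c x" by blast
      then show "y \<in> cone v A"
        unfolding cone_def using A(4) by (intro CollectI exI[of _ "c \<circ> v"]) (simp add: sum.reindex)
    qed
    then have "F = {\<Sum>x\<in>v ` A. c x *\<^sub>R x |c. \<forall>x\<in>v ` A. 0 \<le> c x} \<inter> sphere 0 1"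
      unfolding F_def by (simp only:)
    moreover have "span F = span (v ` A)"
    proof (intro span_eq[THEN iffD2] conjI)
      show "F \<subseteq> span (v ` A)" using in_span by (auto simp: F_def)
      have "v ` A \<subseteq> F" using gen[OF _ fin] v(1) A(2) by (auto simp: F_def)
      then show "v ` A \<subseteq> span F" by (auto intro: span_base)
    qed
    ultimately show ?thesis using fin A(5) by (intro tangent_face_vectors[of _ F]) auto
  qed
  ultimately have "scribed_cyclic_vertices n k v"
    by (rule scribed_cyclic_vertices.intro)
  then show ?thesis by blast
qed

theorem theorem2:
  fixes k :: nat
  assumes "CARD('d::{finite,linorder}) > 3"
    and "1 \<le> k" and "k \<le> CARD('d) - 1"
  shows "\<exists>N::nat. \<forall>n\<ge>N. \<forall>C :: (real^'d::{finite,linorder}) set. cyclic_polytope n C \<longrightarrow> \<not> k_scribable k C"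
proof (intro exI allI impI notI)
  fix n and C :: "(real ^ 'd::{finite,linorder}) set"
  \<comment> \<open>The threshold \<open>CARD('d) + 7\<close> comes from the facet case; it also
    covers the bound \<open>CARD('d) + 4\<close> of the other case.\<close>
  assume n: "CARD('d) + 7 \<le> n" and C: "cyclic_polytope n C" and k: "k_scribable k C"
  obtain v :: "nat \<Rightarrow> real \<times> (real, 'd) vec" where "scribed_cyclic_vertices n k v"
    using scribed_cyclic_vertices_exist[OF C _ k] assms(1) by auto
  then interpret scribed_cyclic_vertices n k v .
  show False
  proof (cases "k + 1 = CARD('d)")
    case True
    then show False using no_scribed_facets n assms(1) by simp
  next
    case False
    then have "k + 2 \<le> CARD('d)" using assms(1,3) by linarith
    then show False using no_scribed_low n assms by simp
  qed
qed

end
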